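(* Let $(X_1,Y_1),\dots,(X_n,Y_n)$ be independent data pairs distributed as $(X,Y)$, where $Y=a+\int_{\mathcal I}bX+\varepsilon$ as described in the context, and suppose that $$\int_{\mathcal I}b^2<\infty,\qquad E\|X\|^4<\infty,\qquad E(\varepsilon^2)<\infty .$$ Then, for each $j\ge1$, $$\widehat K^j(b)=K^j(b)+n^{-1/2}\xi_j+n^{-1}\eta_j,$$ where $$\xi_j=K^{j-1}(\xi_0)+\sum_{k=0}^{j-2}K^k(\zeta_{j-k-1})$$ and $\eta_j$ satisfies $$\|\eta_j\|\le R_1^{j-1}\|\eta_0\|+R_2\sum_{k=1}^{j-1}R_1^{j-k-1}\bigl(\|K^k(b)\|+|||K^{k-1}|||\,\|\xi_0\|\bigr)+R_2\,|||\xi|||\sum_{k=1}^{j-1}R_1^{j-k-1}\sum_{\ell=0}^{k-2}|||K^\ell|||\,\|K^{k-\ell-1}(b)\| .$$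
   Context: $\mathcal I$ is a nondegenerate compact interval; $X$ is a random function on $\mathcal I$ with $\int_{\mathcal I}E(X^2)<\infty$; $a$ is a scalar, $b$ a function on $\mathcal I$, and $\varepsilon$ a scalar random variable with $E(\varepsilon\mid X)=0$. Put $\mu=E(X)$, $\bar X=n^{-1}\sum_iX_i$, $\bar Y=n^{-1}\sum_iY_i$. $\|x\|^2=\int_{\mathcal I}x^2$ for functions of one variable, and $|||L|||^2=\int_{\mathcal I}\int_{\mathcal I}L^2$ for functions of two variables. $K(s,t)=\operatorname{cov}\{X(s),X(t)\}$; $K$ also denotes the operator $K(\psi)(t)=\int_{\mathcal I}\psi(s)K(s,t)\,ds$, and $K^j$ is its $j$-fold iterate (for $j\ge1$, $|||K^j|||$ is the norm of its kernel). $K^0$ is the identity, with the convention $|||K^0|||=1$. Empty sums are zero. Estimators: $\widehat K(s,t)=n^{-1}\sum_{i=1}^n\{X_i(s)-\bar X(s)\}\{X_i(t)-\bar X(t)\}$; $\widehat K^1(b)=n^{-1}\sum_{i=1}^n(X_i-\bar X)(Y_i-\bar Y)$ (an estimator of $K(b)$); and $\widehat K^{j+1}(b)(t)=\int_{\mathcal I}\widehat K^j(b)(s)\,\widehat K(s,t)\,ds$ for $j\ge1$. Write $(1-E)Z=Z-E(Z)$, and define $$\xi(s,t)=n^{-1/2}\sum_{i=1}^n(1-E)\{X_i(s)-\mu(s)\}\{X_i(t)-\mu(t)\},\qquad \xi_0(t)=n^{-1/2}\sum_{i=1}^n(1-E)\{X_i(t)-\mu(t)\}\{Y_i-E(Y_i)\},$$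 $$\eta(s,t)=-n\{\bar X(s)-\mu(s)\}\{\bar X(t)-\mu(t)\},\qquad \eta_0(t)=-n\{\bar X(t)-\mu(t)\}(\bar Y-E\bar Y),$$ $$R_1=|||K|||+n^{-1/2}|||\xi|||+n^{-1}|||\eta|||,\qquad R_2=|||\xi|||+|||\eta|||,\qquad \zeta_j(t)=\int_{\mathcal I}K^j(b)(s)\,\xi(s,t)\,ds\quad(j\ge1).$$ *)

theory Defs
  imports "HOL-Probability.Probability"
begin

text \<open>
  Functions on the compact interval \<open>I\<close> are elements of \<open>real \<Rightarrow> real\<close>, integrated against Lebesgue
  measure on \<open>I\<close>; their values off \<open>I\<close> are irrelevant. A random function is a jointly measurable
  real process. Its distribution and the sigma-algebra it generates are those of the map
  \<open>\<omega> \<mapsto> X \<omega>\<close> restricted to \<open>I\<close> into the product space \<open>real^I\<close>.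
\<close>

definition random_function :: "'w measure \<Rightarrow> real set \<Rightarrow> ('w \<Rightarrow> real \<Rightarrow> real) \<Rightarrow> bool" where
  "random_function M I X \<longleftrightarrow>
     (\<lambda>(\<omega>, t). X \<omega> t) \<in> borel_measurable (M \<Otimes>\<^sub>M lebesgue_on I)"

definition path_space :: "real set \<Rightarrow> (real \<Rightarrow> real) measure" where
  "path_space I = PiM I (\<lambda>_. borel)"

definition sigma_gen :: "'w measure \<Rightarrow> real set \<Rightarrow> ('w \<Rightarrow> real \<Rightarrow> real) \<Rightarrow> 'w measure" where
  "sigma_gen M I X = vimage_algebra (space M) (\<lambda>\<omega>. restrict (X \<omega>) I) (path_space I)"

definition norm1 :: "real set \<Rightarrow> (real \<Rightarrow> real) \<Rightarrow> real" where
  "norm1 I x = sqrt (LINT t|lebesgue_on I. (x t)\<^sup>2)"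

definition norm2 :: "real set \<Rightarrow> (real \<Rightarrow> real \<Rightarrow> real) \<Rightarrow> real" where
  "norm2 I L = sqrt (LINT s|lebesgue_on I. LINT t|lebesgue_on I. (L s t)\<^sup>2)"

definition int_op :: "real set \<Rightarrow> (real \<Rightarrow> real \<Rightarrow> real) \<Rightarrow> (real \<Rightarrow> real) \<Rightarrow> real \<Rightarrow> real" where
  "int_op I L \<psi> t = (LINT s|lebesgue_on I. \<psi> s * L s t)"

definition op_pow :: "real set \<Rightarrow> (real \<Rightarrow> real \<Rightarrow> real) \<Rightarrow> nat \<Rightarrow> (real \<Rightarrow> real) \<Rightarrow> real \<Rightarrow> real" where
  "op_pow I L j = int_op I L ^^ j"

text \<open>\<open>kernel_pow I L j\<close> is, for \<open>j \<ge> 1\<close>, the kernel of the operator \<open>op_pow I L j\<close>. The identity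
  (\<open>j = 0\<close>) has no kernel; \<open>norm_pow\<close> encodes the convention that its norm is 1.\<close>

definition kernel_pow :: "real set \<Rightarrow> (real \<Rightarrow> real \<Rightarrow> real) \<Rightarrow> nat \<Rightarrow> real \<Rightarrow> real \<Rightarrow> real" where
  "kernel_pow I L j = ((\<lambda>N s t. LINT u|lebesgue_on I. N s u * L u t) ^^ (j - 1)) L"

definition norm_pow :: "real set \<Rightarrow> (real \<Rightarrow> real \<Rightarrow> real) \<Rightarrow> nat \<Rightarrow> real" where
  "norm_pow I L j = (if j = 0 then 1 else norm2 I (kernel_pow I L j))"

definition mean_fun :: "'w measure \<Rightarrow> ('w \<Rightarrow> real \<Rightarrow> real) \<Rightarrow> real \<Rightarrow> real" where
  "mean_fun M X t = (LINT \<omega>|M. X \<omega> t)"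

definition cov_kernel :: "'w measure \<Rightarrow> ('w \<Rightarrow> real \<Rightarrow> real) \<Rightarrow> real \<Rightarrow> real \<Rightarrow> real" where
  "cov_kernel M X s t = (LINT \<omega>|M. (X \<omega> s - mean_fun M X s) * (X \<omega> t - mean_fun M X t))"

definition centre :: "'w measure \<Rightarrow> ('w \<Rightarrow> real) \<Rightarrow> 'w \<Rightarrow> real" where
  "centre M Z \<omega> = Z \<omega> - (LINT \<omega>'|M. Z \<omega>')"

text \<open>The sample is \<open>(Xs i, Ys i)\<close> for \<open>i \<in> {1..n}\<close>; all sample quantities depend on the outcome \<open>\<omega>\<close>.\<close>

definition X_bar :: "nat \<Rightarrow> (nat \<Rightarrow> 'w \<Rightarrow> real \<Rightarrow> real) \<Rightarrow> 'w \<Rightarrow> real \<Rightarrow> real" where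
  "X_bar n Xs \<omega> t = (\<Sum>i=1..n. Xs i \<omega> t) / real n"

definition Y_bar :: "nat \<Rightarrow> (nat \<Rightarrow> 'w \<Rightarrow> real) \<Rightarrow> 'w \<Rightarrow> real" where
  "Y_bar n Ys \<omega> = (\<Sum>i=1..n. Ys i \<omega>) / real n"

definition K_hat :: "nat \<Rightarrow> (nat \<Rightarrow> 'w \<Rightarrow> real \<Rightarrow> real) \<Rightarrow> 'w \<Rightarrow> real \<Rightarrow> real \<Rightarrow> real" where
  "K_hat n Xs \<omega> s t =
     (\<Sum>i=1..n. (Xs i \<omega> s - X_bar n Xs \<omega> s) * (Xs i \<omega> t - X_bar n Xs \<omega> t)) / real n"

definition K_hat1_b ::
    "nat \<Rightarrow> (nat \<Rightarrow> 'w \<Rightarrow> real \<Rightarrow> real) \<Rightarrow> (nat \<Rightarrow> 'w \<Rightarrow> real) \<Rightarrow> 'w \<Rightarrow> real \<Rightarrow> real" where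
  "K_hat1_b n Xs Ys \<omega> t =
     (\<Sum>i=1..n. (Xs i \<omega> t - X_bar n Xs \<omega> t) * (Ys i \<omega> - Y_bar n Ys \<omega>)) / real n"

text \<open>Meaningful for \<open>j \<ge> 1\<close> only. The recursion starts at the estimator \<open>K_hat1_b\<close>, which is computed
  from the data without \<open>b\<close>.\<close>

definition K_hat_pow_b ::
    "real set \<Rightarrow> nat \<Rightarrow> (nat \<Rightarrow> 'w \<Rightarrow> real \<Rightarrow> real) \<Rightarrow> (nat \<Rightarrow> 'w \<Rightarrow> real) \<Rightarrow> nat \<Rightarrow> 'w \<Rightarrow> real \<Rightarrow> real"
  where
  "K_hat_pow_b I n Xs Ys j \<omega> = (int_op I (K_hat n Xs \<omega>) ^^ (j - 1)) (K_hat1_b n Xs Ys \<omega>)"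

definition \<xi>_ker ::
    "'w measure \<Rightarrow> ('w \<Rightarrow> real \<Rightarrow> real) \<Rightarrow> nat \<Rightarrow> (nat \<Rightarrow> 'w \<Rightarrow> real \<Rightarrow> real) \<Rightarrow> 'w \<Rightarrow> real \<Rightarrow> real \<Rightarrow> real"
  where
  "\<xi>_ker M X n Xs \<omega> s t =
     (\<Sum>i=1..n. centre M (\<lambda>\<omega>'. (Xs i \<omega>' s - mean_fun M X s) * (Xs i \<omega>' t - mean_fun M X t)) \<omega>)
       / sqrt (real n)"

definition \<xi>_zero ::
    "'w measure \<Rightarrow> ('w \<Rightarrow> real \<Rightarrow> real) \<Rightarrow> nat \<Rightarrow> (nat \<Rightarrow> 'w \<Rightarrow> real \<Rightarrow> real) \<Rightarrow> (nat \<Rightarrow> 'w \<Rightarrow> real)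
       \<Rightarrow> 'w \<Rightarrow> real \<Rightarrow> real"
  where
  "\<xi>_zero M X n Xs Ys \<omega> t =
     (\<Sum>i=1..n. centre M (\<lambda>\<omega>'. (Xs i \<omega>' t - mean_fun M X t) * (Ys i \<omega>' - (LINT \<omega>''|M. Ys i \<omega>''))) \<omega>)
       / sqrt (real n)"

definition \<eta>_ker ::
    "'w measure \<Rightarrow> ('w \<Rightarrow> real \<Rightarrow> real) \<Rightarrow> nat \<Rightarrow> (nat \<Rightarrow> 'w \<Rightarrow> real \<Rightarrow> real) \<Rightarrow> 'w \<Rightarrow> real \<Rightarrow> real \<Rightarrow> real"
  where
  "\<eta>_ker M X n Xs \<omega> s t =
     - real n * (X_bar n Xs \<omega> s - mean_fun M X s) * (X_bar n Xs \<omega> t - mean_fun M X t)"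

definition \<eta>_zero ::
    "'w measure \<Rightarrow> ('w \<Rightarrow> real \<Rightarrow> real) \<Rightarrow> nat \<Rightarrow> (nat \<Rightarrow> 'w \<Rightarrow> real \<Rightarrow> real) \<Rightarrow> (nat \<Rightarrow> 'w \<Rightarrow> real)
       \<Rightarrow> 'w \<Rightarrow> real \<Rightarrow> real"
  where
  "\<eta>_zero M X n Xs Ys \<omega> t =
     - real n * (X_bar n Xs \<omega> t - mean_fun M X t) * (Y_bar n Ys \<omega> - (LINT \<omega>'|M. Y_bar n Ys \<omega>'))"

text \<open>In the remaining definitions \<open>K\<close>, \<open>\<xi>\<close>, \<open>\<eta>\<close>, \<open>\<xi>0\<close> stand for the (realised) kernels and function
  above.\<close>

definition R1 ::
    "real set \<Rightarrow> nat \<Rightarrow> (real \<Rightarrow> real \<Rightarrow> real) \<Rightarrow> (real \<Rightarrow> real \<Rightarrow> real) \<Rightarrow> (real \<Rightarrow> real \<Rightarrow> real) \<Rightarrow> real"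
  where
  "R1 I n K \<xi> \<eta> = norm2 I K + norm2 I \<xi> / sqrt (real n) + norm2 I \<eta> / real n"

definition R2 :: "real set \<Rightarrow> (real \<Rightarrow> real \<Rightarrow> real) \<Rightarrow> (real \<Rightarrow> real \<Rightarrow> real) \<Rightarrow> real" where
  "R2 I \<xi> \<eta> = norm2 I \<xi> + norm2 I \<eta>"

definition \<zeta> ::
    "real set \<Rightarrow> (real \<Rightarrow> real \<Rightarrow> real) \<Rightarrow> (real \<Rightarrow> real) \<Rightarrow> (real \<Rightarrow> real \<Rightarrow> real) \<Rightarrow> nat \<Rightarrow> real \<Rightarrow> real"
  where
  "\<zeta> I K b \<xi> j t = (LINT s|lebesgue_on I. op_pow I K j b s * \<xi> s t)"

text \<open>For \<open>j \<ge> 1\<close>, \<open>{..<j - 1}\<close> is the index range from 0 to \<open>j - 2\<close>, empty when \<open>j = 1\<close>.\<close>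

definition \<xi>_term ::
    "real set \<Rightarrow> (real \<Rightarrow> real \<Rightarrow> real) \<Rightarrow> (real \<Rightarrow> real) \<Rightarrow> (real \<Rightarrow> real \<Rightarrow> real) \<Rightarrow> (real \<Rightarrow> real)
       \<Rightarrow> nat \<Rightarrow> real \<Rightarrow> real"
  where
  "\<xi>_term I K b \<xi> \<xi>0 j t =
     op_pow I K (j - 1) \<xi>0 t + (\<Sum>k<j - 1. op_pow I K k (\<zeta> I K b \<xi> (j - k - 1)) t)"

end

theory Submission
  imports Defs
begin

text \<open>
  For every outcome, \<open>K_hat = K + \<xi> / sqrt n + \<eta> / n\<close> and
  \<open>K_hat1_b = K(b) + \<xi>0 / sqrt n + \<eta>0 / n\<close> almost everywhere; the second identity uses
  \<open>E (X - \<mu>) (Y - E Y) = K(b)\<close>, which is Fubini's theorem together with the fact that the error is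
  uncorrelated with \<open>X\<close>. Substituting the expansion of order \<open>j\<close> into
  \<open>K_hat\<close> and collecting powers of \<open>n\<close> gives \<open>\<xi>_(j+1) = K(\<xi>_j) + \<zeta>_j\<close> and
  \<open>\<eta>_(j+1) = K_hat(\<eta>_j) + (\<xi> + \<eta> / sqrt n)(\<xi>_j) + \<eta>(K^j(b))\<close>. Since the Hilbert-Schmidt norm
  dominates the operator norm and \<open>|||K_hat||| \<le> R1\<close>, this is a linear recursive inequality for
  \<open>\<parallel>\<eta>_j\<parallel>\<close>, and unrolling it yields the bound.
\<close>

section \<open>Square-integrable functions and kernels\<close>

text \<open>The obstacle throughout is that a kernel in L2 has square-integrable sections only for
  almost every \<open>t\<close>, while the Bochner integral of a nonintegrable function is 0. An
  integral operator is therefore homogeneous at every point but additive only almost everywhere, and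
  each iteration must carry an almost-everywhere identity through one more integral. The remainder
  is not built by recursion: it is \<open>n\<close> times the difference between the estimator and
  the first two terms. The expansion then holds by definition, measurability follows from that of
  explicit terms, and the recursion is a theorem about this difference. The analytic argument is
  deterministic and runs at a fixed outcome. Probability identifies the centring constants with
  \<open>K\<close> and K(b), and makes the sample paths square-integrable for almost every outcome.
  The kernel lemmas are stated over arbitrary sigma-finite measures because they serve both sides:
  an expectation is an integral against a kernel one of whose variables is the outcome.\<close>

definition sq_integrable :: "'a measure \<Rightarrow> ('a \<Rightarrow> real) \<Rightarrow> bool" where
  "sq_integrable N f \<longleftrightarrow> f \<in> borel_measurable N \<and> integrable N (\<lambda>x. (f x)\<^sup>2)"

lemma sq_integrable_measurable: "sq_integrable N f \<Longrightarrow> f \<in> borel_measurable N"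
  by (simp add: sq_integrable_def)

lemma sq_integrable_integrable: "sq_integrable N f \<Longrightarrow> integrable N (\<lambda>x. (f x)\<^sup>2)"
  by (simp add: sq_integrable_def)

lemma integrable_mult_sq:
  assumes "sq_integrable N f" "sq_integrable N g"
  shows "integrable N (\<lambda>x. f x * g x)"
proof (rule Bochner_Integration.integrable_bound)
  show "integrable N (\<lambda>x. (f x)\<^sup>2 + (g x)\<^sup>2)"
    using assms by (simp add: sq_integrable_def)
  show "(\<lambda>x. f x * g x) \<in> borel_measurable N"
    using assms by (intro borel_measurable_times) (simp_all add: sq_integrable_def)
  have "\<bar>u * v\<bar> \<le> u\<^sup>2 + v\<^sup>2" for u v :: real
  proof -
    have "2 * (\<bar>u\<bar> * \<bar>v\<bar>) \<le> u\<^sup>2 + v\<^sup>2"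
      using sum_squares_bound[of "\<bar>u\<bar>" "\<bar>v\<bar>"] by simp
    moreover have "0 \<le> \<bar>u\<bar> * \<bar>v\<bar>" by simp
    ultimately show ?thesis unfolding abs_mult by linarith
  qed
  then show "AE x in N. norm (f x * g x) \<le> norm ((f x)\<^sup>2 + (g x)\<^sup>2)"
    by (intro AE_I2) (metis abs_ge_self order_trans real_norm_def)
qed

lemma sq_integrable_add:
  assumes "sq_integrable N f" "sq_integrable N g"
  shows "sq_integrable N (\<lambda>x. f x + g x)"
  using assms integrable_mult_sq[OF assms]
  by (auto simp: sq_integrable_def power2_sum mult.assoc)

lemma sq_integrable_cmult: "sq_integrable N f \<Longrightarrow> sq_integrable N (\<lambda>x. c * f x)"
  by (auto simp: sq_integrable_def power_mult_distrib)

lemma sq_integrable_divide: "sq_integrable N f \<Longrightarrow> sq_integrable N (\<lambda>x. f x / c)"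
  using sq_integrable_cmult[of N f "1 / c"] by simp

lemma sq_integrable_diff:
  assumes "sq_integrable N f" "sq_integrable N g"
  shows "sq_integrable N (\<lambda>x. f x - g x)"
  using sq_integrable_add[OF assms(1) sq_integrable_cmult[OF assms(2), of "-1"]] by simp

lemma sq_integrable_sum:
  "(\<And>i. i \<in> A \<Longrightarrow> sq_integrable N (f i)) \<Longrightarrow> sq_integrable N (\<lambda>x. \<Sum>i\<in>A. f i x)"
  by (induction A rule: infinite_finite_induct) (auto intro: sq_integrable_add simp: sq_integrable_def[of _ "\<lambda>_. 0"])

lemma (in finite_measure) sq_integrable_const: "sq_integrable M (\<lambda>_. c)"
  by (simp add: sq_integrable_def)

lemma (in finite_measure) sq_integrable_imp_integrable: "sq_integrable M f \<Longrightarrow> integrable M f"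
  by (simp add: sq_integrable_def square_integrable_imp_integrable)

lemma sq_integrable_cong:
  "(\<And>x. x \<in> space N \<Longrightarrow> f x = g x) \<Longrightarrow> sq_integrable N f \<longleftrightarrow> sq_integrable N g"
  unfolding sq_integrable_def
  by (intro conj_cong measurable_cong Bochner_Integration.integrable_cong) auto

lemma sq_integrable_cong_AE:
  assumes "sq_integrable N f" "g \<in> borel_measurable N" "AE x in N. f x = g x"
  shows "sq_integrable N g"
  unfolding sq_integrable_def
proof
  show "integrable N (\<lambda>x. (g x)\<^sup>2)"
    by (rule integrable_cong_AE_imp[where g = "\<lambda>x. (f x)\<^sup>2"]) (use assms in \<open>auto simp: sq_integrable_def\<close>)
qed fact

text \<open>The nonnegative integral of \<open>(A * g x - C * f x)^2\<close> expands to
  \<open>A * (A * B - C^2)\<close>, so one divides by \<open>A\<close>. If \<open>A = 0\<close>,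
  then \<open>f\<close> vanishes almost everywhere and \<open>C = 0\<close>.\<close>

lemma Cauchy_Schwarz_integral:
  assumes "sq_integrable N f" "sq_integrable N g"
  shows "(LINT x|N. f x * g x)\<^sup>2 \<le> (LINT x|N. (f x)\<^sup>2) * (LINT x|N. (g x)\<^sup>2)"
proof -
  define A where "A = (LINT x|N. (f x)\<^sup>2)"
  define B where "B = (LINT x|N. (g x)\<^sup>2)"
  define C where "C = (LINT x|N. f x * g x)"
  have int: "integrable N (\<lambda>x. (f x)\<^sup>2)" "integrable N (\<lambda>x. (g x)\<^sup>2)" "integrable N (\<lambda>x. f x * g x)"
    using assms integrable_mult_sq[OF assms] by (auto simp: sq_integrable_def)
  have "0 \<le> (LINT x|N. (A * g x - C * f x)\<^sup>2)" by simp
  also have "\<dots> = (LINT x|N. A\<^sup>2 * (g x)\<^sup>2 + C\<^sup>2 * (f x)\<^sup>2 - 2 * A * C * (f x * g x))"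
    by (intro Bochner_Integration.integral_cong) (auto simp: power2_eq_square algebra_simps)
  also have "\<dots> = A\<^sup>2 * B + C\<^sup>2 * A - 2 * A * C * C"
    using int by (simp add: A_def B_def C_def)
  also have "\<dots> = A * (A * B - C\<^sup>2)"
    by (simp add: power2_eq_square algebra_simps)
  finally have *: "0 \<le> A * (A * B - C\<^sup>2)" .
  have "A \<ge> 0" by (simp add: A_def)
  show ?thesis
  proof (cases "A = 0")
    case True
    then have "AE x in N. (f x)\<^sup>2 = 0"
      using integral_nonneg_eq_0_iff_AE[OF int(1)] by (simp add: A_def)
    then have "C = (LINT x|N. 0)"
      unfolding C_def using assms by (intro integral_cong_AE) (auto simp: sq_integrable_def)
    then show ?thesis by (simp add: A_def[symmetric] C_def[symmetric] True)
  next
    case False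
    with \<open>A \<ge> 0\<close> * have "0 \<le> A * B - C\<^sup>2" by (simp add: zero_le_mult_iff)
    then show ?thesis by (simp add: A_def B_def C_def)
  qed
qed

lemma sqrt_integral_sq_triangle:
  assumes "sq_integrable N f" "sq_integrable N g"
  shows "sqrt (LINT x|N. (f x + g x)\<^sup>2) \<le> sqrt (LINT x|N. (f x)\<^sup>2) + sqrt (LINT x|N. (g x)\<^sup>2)"
proof (rule real_le_lsqrt)
  let ?A = "LINT x|N. (f x)\<^sup>2" and ?B = "LINT x|N. (g x)\<^sup>2" and ?C = "LINT x|N. f x * g x"
  have "?C \<le> sqrt ?A * sqrt ?B"
    using Cauchy_Schwarz_integral[OF assms] by (simp add: real_le_rsqrt flip: real_sqrt_mult)
  moreover have "(LINT x|N. (f x + g x)\<^sup>2) = ?A + ?B + 2 * ?C"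
    using assms integrable_mult_sq[OF assms]
    by (simp add: power2_sum sq_integrable_def mult.assoc)
  ultimately show "(LINT x|N. (f x + g x)\<^sup>2) \<le> (sqrt ?A + sqrt ?B)\<^sup>2"
    by (simp add: power2_sum)
qed simp_all

section \<open>Square-integrable functions on a product, and the integral operators they
  define\<close>

lemma sq_integrable_swap:
  assumes "sigma_finite_measure P" "sigma_finite_measure Q"
    and "sq_integrable (P \<Otimes>\<^sub>M Q) (\<lambda>(x, y). f x y)"
  shows "sq_integrable (Q \<Otimes>\<^sub>M P) (\<lambda>(y, x). f x y)"
proof -
  interpret pair_sigma_finite Q P using assms by (simp add: pair_sigma_finite_def)
  have [measurable]: "(\<lambda>(x, y). f x y) \<in> borel_measurable (P \<Otimes>\<^sub>M Q)"
    using assms(3) by (simp add: sq_integrable_def)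
  have "integrable (Q \<Otimes>\<^sub>M P) (\<lambda>(y, x). (f x y)\<^sup>2)"
    using assms(3) integrable_product_swap_iff[of "\<lambda>(y, x). (f x y)\<^sup>2"]
    by (simp add: sq_integrable_def case_prod_unfold)
  then show ?thesis by (simp add: sq_integrable_def case_prod_unfold)
qed

lemma sq_integrable_sections:
  assumes "sigma_finite_measure P" "sigma_finite_measure Q"
    and f: "sq_integrable (P \<Otimes>\<^sub>M Q) (\<lambda>(x, y). f x y)"
  shows sq_integrable_section_fst: "AE x in P. sq_integrable Q (f x)"
    and sq_integrable_section_snd: "AE y in Q. sq_integrable P (\<lambda>x. f x y)"
    and integrable_sq_fst: "integrable P (\<lambda>x. LINT y|Q. (f x y)\<^sup>2)"
    and integrable_sq_snd: "integrable Q (\<lambda>y. LINT x|P. (f x y)\<^sup>2)"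
    and integral_sq_swap: "(LINT y|Q. LINT x|P. (f x y)\<^sup>2) = (LINT x|P. LINT y|Q. (f x y)\<^sup>2)"
proof -
  interpret pair_sigma_finite P Q using assms by (simp add: pair_sigma_finite_def)
  have [measurable]: "(\<lambda>(x, y). f x y) \<in> borel_measurable (P \<Otimes>\<^sub>M Q)"
    using f by (simp add: sq_integrable_def)
  have int: "integrable (P \<Otimes>\<^sub>M Q) (\<lambda>(x, y). (f x y)\<^sup>2)"
    using f by (simp add: sq_integrable_def case_prod_unfold)
  show "AE x in P. sq_integrable Q (f x)"
    using AE_integrable_fst[OF int] AE_space by eventually_elim (simp add: sq_integrable_def)
  show "AE y in Q. sq_integrable P (\<lambda>x. f x y)"
    using AE_integrable_snd[OF int] AE_space by eventually_elim (simp add: sq_integrable_def)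
  show "integrable P (\<lambda>x. LINT y|Q. (f x y)\<^sup>2)" "integrable Q (\<lambda>y. LINT x|P. (f x y)\<^sup>2)"
    using integrable_fst[OF int] integrable_snd[OF int] .
  show "(LINT y|Q. LINT x|P. (f x y)\<^sup>2) = (LINT x|P. LINT y|Q. (f x y)\<^sup>2)"
    using Fubini_integral[OF int] .
qed

text \<open>The criterion in the direction of Tonelli. The condition on sections keeps the iterated
  integral honest: a nonintegrable section has Bochner integral 0, so integrability of the iterated
  integral alone would say nothing.\<close>

lemma sq_integrable_pairI:
  assumes "sigma_finite_measure P" "sigma_finite_measure Q"
    and "(\<lambda>(x, y). f x y) \<in> borel_measurable (P \<Otimes>\<^sub>M Q)"
    and "AE x in P. sq_integrable Q (f x)"
    and "integrable P (\<lambda>x. LINT y|Q. (f x y)\<^sup>2)"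
  shows "sq_integrable (P \<Otimes>\<^sub>M Q) (\<lambda>(x, y). f x y)"
proof -
  interpret pair_sigma_finite P Q using assms by (simp add: pair_sigma_finite_def)
  note [measurable] = assms(3)
  have "integrable (P \<Otimes>\<^sub>M Q) (\<lambda>(x, y). (f x y)\<^sup>2)"
  proof (rule Fubini_integrable)
    show "AE x in P. integrable Q (\<lambda>y. case (x, y) of (x, y) \<Rightarrow> (f x y)\<^sup>2)"
      using assms(4) by eventually_elim (simp add: sq_integrable_def)
  qed (use assms(5) in simp_all)
  then show ?thesis by (simp add: sq_integrable_def case_prod_unfold)
qed

lemma sq_integrable_tensor:
  assumes "sigma_finite_measure P" "sigma_finite_measure Q"
    and "sq_integrable P f" "sq_integrable Q g"
  shows "sq_integrable (P \<Otimes>\<^sub>M Q) (\<lambda>(x, y). f x * g y)"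
proof (rule sq_integrable_pairI[OF assms(1,2)])
  note [measurable] = assms(3,4)[THEN sq_integrable_measurable]
  show "(\<lambda>(x, y). f x * g y) \<in> borel_measurable (P \<Otimes>\<^sub>M Q)" by measurable
  show "AE x in P. sq_integrable Q (\<lambda>y. f x * g y)"
    by (intro AE_I2 sq_integrable_cmult assms)
  show "integrable P (\<lambda>x. LINT y|Q. (f x * g y)\<^sup>2)"
    using assms(3) by (simp add: power_mult_distrib sq_integrable_def)
qed

text \<open>Cauchy-Schwarz at almost every \<open>y\<close>, then integration over \<open>y\<close>:
  the Hilbert-Schmidt norm dominates the operator norm. Two measures are allowed so that either
  variable of the kernel may be the outcome.\<close>

lemma sq_integrable_kernel_apply:
  assumes P: "sigma_finite_measure P" and Q: "sigma_finite_measure Q"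
    and f: "sq_integrable P f" and L: "sq_integrable (P \<Otimes>\<^sub>M Q) (\<lambda>(x, y). L x y)"
  shows "sq_integrable Q (\<lambda>y. LINT x|P. f x * L x y)"
    and integral_kernel_apply_sq_le:
      "(LINT y|Q. (LINT x|P. f x * L x y)\<^sup>2)
        \<le> (LINT x|P. (f x)\<^sup>2) * (LINT x|P. LINT y|Q. (L x y)\<^sup>2)"
proof -
  interpret pair_sigma_finite P Q using assms by (simp add: pair_sigma_finite_def)
  note [measurable] = f[THEN sq_integrable_measurable] L[THEN sq_integrable_measurable]
  let ?g = "\<lambda>y. LINT x|P. f x * L x y"
  let ?h = "\<lambda>y. (LINT x|P. (f x)\<^sup>2) * (LINT x|P. (L x y)\<^sup>2)"
  have AE: "AE y in Q. (?g y)\<^sup>2 \<le> ?h y"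
    using sq_integrable_section_snd[OF P Q L]
    by eventually_elim (rule Cauchy_Schwarz_integral[OF f])
  have h: "integrable Q ?h"
    using integrable_sq_snd[OF P Q L] by simp
  have "integrable Q (\<lambda>y. (?g y)\<^sup>2)"
    by (rule Bochner_Integration.integrable_bound[OF h])
       (measurable, use AE in eventually_elim, simp)
  then show "sq_integrable Q ?g" by (simp add: sq_integrable_def)
  then have "(LINT y|Q. (?g y)\<^sup>2) \<le> (LINT y|Q. ?h y)"
    by (intro integral_mono_AE h AE sq_integrable_integrable)
  also have "\<dots> = (LINT x|P. (f x)\<^sup>2) * (LINT x|P. LINT y|Q. (L x y)\<^sup>2)"
    by (simp add: integral_sq_swap[OF P Q L])
  finally show "(LINT y|Q. (?g y)\<^sup>2) \<le> (LINT x|P. (f x)\<^sup>2) * (LINT x|P. LINT y|Q. (L x y)\<^sup>2)" .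
qed

text \<open>The section of the composite at \<open>x\<close> is \<open>B\<close> applied to
  \<open>A x\<close>, so the operator bound controls its norm by that of \<open>A x\<close>, which
  is square-integrable in \<open>x\<close>. With \<open>Q = lebesgue_on I\<close> this gives
  iterated kernels, with \<open>Q = M\<close> the covariance kernel.\<close>

lemma sq_integrable_kernel_comp:
  assumes P: "sigma_finite_measure P" and Q: "sigma_finite_measure Q" and R: "sigma_finite_measure R"
    and A: "sq_integrable (P \<Otimes>\<^sub>M Q) (\<lambda>(x, y). A x y)"
    and B: "sq_integrable (Q \<Otimes>\<^sub>M R) (\<lambda>(y, z). B y z)"
  shows "sq_integrable (P \<Otimes>\<^sub>M R) (\<lambda>(x, z). LINT y|Q. A x y * B y z)"
proof (rule sq_integrable_pairI[OF P R])
  interpret Q: sigma_finite_measure Q by fact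
  interpret R: sigma_finite_measure R by fact
  note [measurable] = A[THEN sq_integrable_measurable] B[THEN sq_integrable_measurable]
  show "(\<lambda>(x, z). LINT y|Q. A x y * B y z) \<in> borel_measurable (P \<Otimes>\<^sub>M R)" by measurable
  show "AE x in P. sq_integrable R (\<lambda>z. LINT y|Q. A x y * B y z)"
    using sq_integrable_section_fst[OF P Q A]
    by eventually_elim (rule sq_integrable_kernel_apply[OF Q R _ B])
  let ?h = "\<lambda>x. (LINT y|Q. (A x y)\<^sup>2) * (LINT y|Q. LINT z|R. (B y z)\<^sup>2)"
  have h: "integrable P ?h" using integrable_sq_fst[OF P Q A] by simp
  show "integrable P (\<lambda>x. LINT z|R. (LINT y|Q. A x y * B y z)\<^sup>2)"
  proof (rule Bochner_Integration.integrable_bound[OF h])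
    show "AE x in P. norm (LINT z|R. (LINT y|Q. A x y * B y z)\<^sup>2) \<le> norm (?h x)"
      using sq_integrable_section_fst[OF P Q A]
      by eventually_elim (use integral_kernel_apply_sq_le[OF Q R _ B] in simp)
  qed measurable
qed

text \<open>Fubini at each \<open>z\<close> whose section of \<open>B\<close> is square-integrable.
  The integrand is grouped as \<open>A\<close> times the tensor product of \<open>f\<close> with
  that section; both are in L2 of the product, so their product is integrable.\<close>

lemma kernel_apply_assoc:
  assumes P: "sigma_finite_measure P" and Q: "sigma_finite_measure Q" and R: "sigma_finite_measure R"
    and f: "sq_integrable P f"
    and A: "sq_integrable (P \<Otimes>\<^sub>M Q) (\<lambda>(x, y). A x y)"
    and B: "sq_integrable (Q \<Otimes>\<^sub>M R) (\<lambda>(y, z). B y z)"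
  shows "AE z in R. (LINT y|Q. (LINT x|P. f x * A x y) * B y z)
    = (LINT x|P. f x * (LINT y|Q. A x y * B y z))"
  using sq_integrable_section_snd[OF Q R B]
proof eventually_elim
  case (elim z)
  interpret pair_sigma_finite P Q using assms by (simp add: pair_sigma_finite_def)
  have "integrable (P \<Otimes>\<^sub>M Q) (\<lambda>p. (case p of (x, y) \<Rightarrow> A x y) * (case p of (x, y) \<Rightarrow> f x * B y z))"
    by (intro integrable_mult_sq A sq_integrable_tensor[OF P Q] f elim)
  then have "integrable (P \<Otimes>\<^sub>M Q) (\<lambda>(x, y). f x * (A x y * B y z))"
    by (simp add: case_prod_unfold mult_ac)
  from Fubini_integral[OF this] show ?case
    by (simp add: mult.assoc flip: integral_mult_left_zero)
qed

section \<open>Iterated integral operators\<close>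

lemma norm1_nonneg: "0 \<le> norm1 I f"
  by (simp add: norm1_def)

lemma norm2_nonneg: "0 \<le> norm2 I L"
  by (simp add: norm2_def)

lemma norm2_cmult: "norm2 I (\<lambda>s t. c * L s t) = \<bar>c\<bar> * norm2 I L"
  by (simp add: norm2_def power_mult_distrib real_sqrt_mult)

lemma norm1_triangle:
  "sq_integrable (lebesgue_on I) f \<Longrightarrow> sq_integrable (lebesgue_on I) g \<Longrightarrow>
    norm1 I (\<lambda>t. f t + g t) \<le> norm1 I f + norm1 I g"
  unfolding norm1_def by (rule sqrt_integral_sq_triangle)

lemma norm1_cong_AE:
  assumes "f \<in> borel_measurable (lebesgue_on I)" "g \<in> borel_measurable (lebesgue_on I)"
    and "AE t in lebesgue_on I. f t = g t"
  shows "norm1 I f = norm1 I g"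
  unfolding norm1_def using assms by (auto intro!: integral_cong_AE)

lemma norm1_sum_le:
  assumes "\<And>i. i \<in> A \<Longrightarrow> sq_integrable (lebesgue_on I) (f i)"
  shows "norm1 I (\<lambda>t. \<Sum>i\<in>A. f i t) \<le> (\<Sum>i\<in>A. norm1 I (f i))"
  using assms
proof (induction A rule: infinite_finite_induct)
  case (insert i A)
  then have "norm1 I (\<lambda>t. f i t + (\<Sum>i\<in>A. f i t)) \<le> norm1 I (f i) + norm1 I (\<lambda>t. \<Sum>i\<in>A. f i t)"
    by (intro norm1_triangle sq_integrable_sum) auto
  also have "\<dots> \<le> norm1 I (f i) + (\<Sum>i\<in>A. norm1 I (f i))"
    using insert by simp
  finally show ?case using insert.hyps by simp
qed (simp_all add: norm1_def)

text \<open>There is no such step from 0 to 1: by truncated subtraction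
  \<open>kernel_pow I L 0\<close> is already \<open>L\<close>.\<close>

lemma kernel_pow_Suc_Suc:
  "kernel_pow I L (Suc (Suc j)) s t = (LINT u|lebesgue_on I. kernel_pow I L (Suc j) s u * L u t)"
  by (simp add: kernel_pow_def)

lemma op_pow_0: "op_pow I L 0 f = f"
  by (simp add: op_pow_def)

lemma op_pow_Suc: "op_pow I L (Suc j) f = int_op I L (op_pow I L j f)"
  by (simp add: op_pow_def)

section \<open>Hilbert-Schmidt operators on a set of finite Lebesgue measure\<close>

locale lmeasurable_set =
  fixes I :: "real set"
  assumes lmeasurable_I: "I \<in> lmeasurable"
begin

sublocale domain: finite_measure "lebesgue_on I"
  by (rule finite_measure_lebesgue_on[OF lmeasurable_I])

sublocale square: pair_sigma_finite "lebesgue_on I" "lebesgue_on I" ..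

abbreviation L2_fun :: "(real \<Rightarrow> real) \<Rightarrow> bool" where
  "L2_fun \<equiv> sq_integrable (lebesgue_on I)"

abbreviation L2_kernel :: "(real \<Rightarrow> real \<Rightarrow> real) \<Rightarrow> bool" where
  "L2_kernel L \<equiv> sq_integrable (lebesgue_on I \<Otimes>\<^sub>M lebesgue_on I) (\<lambda>(s, t). L s t)"

lemma L2_kernel_add:
  assumes "L2_kernel L" "L2_kernel L'"
  shows "L2_kernel (\<lambda>s t. L s t + L' s t)"
  using sq_integrable_add[OF assms] by (simp add: case_prod_unfold)

lemma L2_kernel_cmult: "L2_kernel L \<Longrightarrow> L2_kernel (\<lambda>s t. c * L s t)"
  using sq_integrable_cmult[of _ "\<lambda>(s, t). L s t" c] by (simp add: case_prod_unfold)

text \<open>Turns the iterated integral into an L2 norm on the square, where the triangle inequality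
  for a single measure applies.\<close>

lemma norm2_eq_integral_square:
  assumes "L2_kernel L"
  shows "norm2 I L = sqrt (LINT p|(lebesgue_on I \<Otimes>\<^sub>M lebesgue_on I). (case p of (s, t) \<Rightarrow> L s t)\<^sup>2)"
  using square.integral_fst[of "\<lambda>s t. (L s t)\<^sup>2"] sq_integrable_integrable[OF assms]
  by (simp add: norm2_def case_prod_unfold)

lemma norm2_triangle:
  assumes "L2_kernel L" "L2_kernel L'"
  shows "norm2 I (\<lambda>s t. L s t + L' s t) \<le> norm2 I L + norm2 I L'"
  using sqrt_integral_sq_triangle[OF assms] L2_kernel_add[OF assms] assms
  by (simp add: norm2_eq_integral_square case_prod_unfold)

lemma L2_int_op: "L2_kernel L \<Longrightarrow> L2_fun f \<Longrightarrow> L2_fun (int_op I L f)"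
  unfolding int_op_def
  by (rule sq_integrable_kernel_apply[OF domain.sigma_finite_measure_axioms domain.sigma_finite_measure_axioms])

lemma norm1_int_op_le:
  assumes "L2_kernel L" "L2_fun f"
  shows "norm1 I (int_op I L f) \<le> norm2 I L * norm1 I f"
  using integral_kernel_apply_sq_le[OF domain.sigma_finite_measure_axioms domain.sigma_finite_measure_axioms assms(2,1)]
  by (simp add: norm1_def norm2_def int_op_def mult.commute flip: real_sqrt_mult)

lemma AE_integrable_int_op:
  assumes "L2_kernel L" "L2_fun f"
  shows "AE t in lebesgue_on I. integrable (lebesgue_on I) (\<lambda>s. f s * L s t)"
  using sq_integrable_section_snd[OF domain.sigma_finite_measure_axioms domain.sigma_finite_measure_axioms assms(1)]
  by eventually_elim (rule integrable_mult_sq[OF assms(2)])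

text \<open>At a \<open>t\<close> where a section of \<open>L\<close> is not square-integrable, an
  integral may default to 0 and additivity may fail, hence the exceptional null set. Scaling has no
  such exception, which is why \<open>int_op_cmult\<close> holds at every \<open>t\<close>.\<close>

lemma int_op_add:
  assumes "L2_kernel L" "L2_fun f" "L2_fun g"
  shows "AE t in lebesgue_on I. int_op I L (\<lambda>s. f s + g s) t = int_op I L f t + int_op I L g t"
  using AE_integrable_int_op[OF assms(1,2)] AE_integrable_int_op[OF assms(1,3)]
  by eventually_elim (simp add: int_op_def distrib_right)

lemma int_op_cmult: "int_op I L (\<lambda>s. c * f s) t = c * int_op I L f t"
  by (simp add: int_op_def mult.assoc)

lemma int_op_sum:
  assumes "L2_kernel L" "\<And>i. i \<in> A \<Longrightarrow> L2_fun (f i)" "finite A"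
  shows "AE t in lebesgue_on I. int_op I L (\<lambda>s. \<Sum>i\<in>A. f i s) t = (\<Sum>i\<in>A. int_op I L (f i) t)"
proof -
  have "AE t in lebesgue_on I. \<forall>i\<in>A. integrable (lebesgue_on I) (\<lambda>s. f i s * L s t)"
    using assms by (intro AE_finite_allI AE_integrable_int_op)
  then show ?thesis
    by eventually_elim (simp add: int_op_def sum_distrib_right)
qed

lemma int_op_kernel_add:
  assumes "L2_kernel L" "L2_kernel L'" "L2_fun f"
  shows "AE t in lebesgue_on I. int_op I (\<lambda>s t. L s t + L' s t) f t = int_op I L f t + int_op I L' f t"
  using AE_integrable_int_op[OF assms(1,3)] AE_integrable_int_op[OF assms(2,3)]
  by eventually_elim (simp add: int_op_def distrib_left)

lemma int_op_kernel_cmult: "int_op I (\<lambda>s t. c * L s t) f t = c * int_op I L f t"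
  by (simp add: int_op_def mult.left_commute)

text \<open>Every section of a jointly measurable kernel is measurable, so a null set of
  \<open>s\<close> is invisible to the integral at each \<open>t\<close> in \<open>I\<close>. This
  passes an almost-everywhere identity under the next application of the operator.\<close>

lemma int_op_cong_AE:
  assumes "L2_kernel L" "L2_fun f" "L2_fun g" "AE s in lebesgue_on I. f s = g s"
    and "t \<in> I"
  shows "int_op I L f t = int_op I L g t"
  unfolding int_op_def
proof (rule integral_cong_AE)
  have [measurable]: "(\<lambda>s. L s t) \<in> borel_measurable (lebesgue_on I)"
    using measurable_Pair1[OF sq_integrable_measurable[OF assms(1)], of t] \<open>t \<in> I\<close>
    by simp
  note [measurable] = assms(2,3)[THEN sq_integrable_measurable]
  show "(\<lambda>s. f s * L s t) \<in> borel_measurable (lebesgue_on I)"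
    "(\<lambda>s. g s * L s t) \<in> borel_measurable (lebesgue_on I)" by measurable
  show "AE s in lebesgue_on I. f s * L s t = g s * L s t"
    using assms(4) by eventually_elim simp
qed

lemma L2_op_pow: "L2_kernel L \<Longrightarrow> L2_fun f \<Longrightarrow> L2_fun (op_pow I L j f)"
  by (induction j) (simp_all add: op_pow_0 op_pow_Suc L2_int_op)

lemma L2_kernel_pow: "L2_kernel L \<Longrightarrow> L2_kernel (kernel_pow I L (Suc j))"
proof (induction j)
  case (Suc j)
  then show ?case
    unfolding kernel_pow_Suc_Suc
    by (intro sq_integrable_kernel_comp domain.sigma_finite_measure_axioms) auto
qed (simp add: kernel_pow_def)

text \<open>Iterates are taken of the map, but their norm is read off a kernel; this is the link,
  with one use of Fubini and hence one more null set per step.\<close>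

lemma op_pow_eq_int_op_kernel_pow:
  assumes "L2_kernel L" "L2_fun f"
  shows "AE t in lebesgue_on I. op_pow I L (Suc j) f t = int_op I (kernel_pow I L (Suc j)) f t"
proof (induction j)
  case 0
  then show ?case by (simp add: op_pow_0 op_pow_Suc kernel_pow_def)
next
  case (Suc j)
  have "AE t in lebesgue_on I. int_op I L (int_op I (kernel_pow I L (Suc j)) f) t
     = int_op I (kernel_pow I L (Suc (Suc j))) f t"
    unfolding int_op_def kernel_pow_Suc_Suc
    by (rule kernel_apply_assoc[OF domain.sigma_finite_measure_axioms domain.sigma_finite_measure_axioms
        domain.sigma_finite_measure_axioms assms(2) L2_kernel_pow[OF assms(1)] assms(1)])
  with AE_space show ?case
  proof eventually_elim
    case (elim t)
    then show ?case
      using int_op_cong_AE[OF assms(1) L2_op_pow[OF assms]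
          L2_int_op[OF L2_kernel_pow[OF assms(1)] assms(2)] Suc, of t]
      by (simp add: op_pow_Suc[of _ _ "Suc j"])
  qed
qed

text \<open>The norm of the iterated kernel is used, not the power of the norm of \<open>L\<close>,
  because it is what the final bound contains. The convention for exponent 0 makes that case an
  equality.\<close>

lemma norm1_op_pow_le:
  assumes "L2_kernel L" "L2_fun f"
  shows "norm1 I (op_pow I L j f) \<le> norm_pow I L j * norm1 I f"
proof (cases j)
  case (Suc i)
  have "norm1 I (op_pow I L (Suc i) f) = norm1 I (int_op I (kernel_pow I L (Suc i)) f)"
    by (intro norm1_cong_AE op_pow_eq_int_op_kernel_pow assms sq_integrable_measurable
        L2_op_pow L2_int_op L2_kernel_pow)
  then show ?thesis
    using norm1_int_op_le[OF L2_kernel_pow[OF assms(1)] assms(2), of i]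
    by (simp add: Suc norm_pow_def)
qed (simp add: op_pow_0 norm_pow_def)

section \<open>The first-order term: square integrability, norm and recursion\<close>

lemma L2_\<zeta>: "L2_kernel K \<Longrightarrow> L2_kernel \<xi> \<Longrightarrow> L2_fun b \<Longrightarrow> L2_fun (\<zeta> I K b \<xi> m)"
  using L2_int_op[of \<xi> "op_pow I K m b"] L2_op_pow[of K b m]
  by (simp add: \<zeta>_def[abs_def] int_op_def[abs_def])

lemma norm1_\<zeta>_le:
  "L2_kernel K \<Longrightarrow> L2_kernel \<xi> \<Longrightarrow> L2_fun b \<Longrightarrow>
    norm1 I (\<zeta> I K b \<xi> m) \<le> norm2 I \<xi> * norm1 I (op_pow I K m b)"
  using norm1_int_op_le[of \<xi> "op_pow I K m b"] L2_op_pow[of K b m]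
  by (simp add: \<zeta>_def[abs_def] int_op_def[abs_def])

lemma L2_\<xi>_term:
  assumes "L2_kernel K" "L2_kernel \<xi>" "L2_fun b" "L2_fun \<xi>0"
  shows "L2_fun (\<xi>_term I K b \<xi> \<xi>0 j)"
  unfolding \<xi>_term_def[abs_def]
  by (intro sq_integrable_add sq_integrable_sum L2_op_pow L2_\<zeta> assms)

text \<open>Source of the norms of \<open>\<xi>0\<close> and of the double sum in the final bound:
  the summand of index \<open>l\<close> is the \<open>l\<close>-th iterate of \<open>K\<close>
  applied to \<open>\<zeta>\<close>, and \<open>\<zeta>\<close> is itself \<open>\<xi>\<close>
  applied to an iterate of \<open>b\<close>.\<close>

lemma norm1_\<xi>_term_le:
  assumes "L2_kernel K" "L2_kernel \<xi>" "L2_fun b" "L2_fun \<xi>0"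
  shows "norm1 I (\<xi>_term I K b \<xi> \<xi>0 j)
    \<le> norm_pow I K (j - 1) * norm1 I \<xi>0
      + norm2 I \<xi> * (\<Sum>l<j - 1. norm_pow I K l * norm1 I (op_pow I K (j - l - 1) b))"
proof -
  have "norm1 I (\<xi>_term I K b \<xi> \<xi>0 j)
    \<le> norm1 I (op_pow I K (j - 1) \<xi>0)
      + norm1 I (\<lambda>t. \<Sum>k<j - 1. op_pow I K k (\<zeta> I K b \<xi> (j - k - 1)) t)"
    unfolding \<xi>_term_def[abs_def]
    by (intro norm1_triangle sq_integrable_sum L2_op_pow L2_\<zeta> assms)
  also have "\<dots> \<le> norm_pow I K (j - 1) * norm1 I \<xi>0
      + (\<Sum>l<j - 1. norm_pow I K l * (norm2 I \<xi> * norm1 I (op_pow I K (j - l - 1) b)))"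
  proof (intro add_mono norm1_op_pow_le assms order_trans[OF norm1_sum_le] sum_mono)
    fix l
    show "norm1 I (op_pow I K l (\<zeta> I K b \<xi> (j - l - 1)))
      \<le> norm_pow I K l * (norm2 I \<xi> * norm1 I (op_pow I K (j - l - 1) b))"
      by (rule order_trans[OF norm1_op_pow_le mult_left_mono[OF norm1_\<zeta>_le]])
         (use assms in \<open>auto intro: L2_\<zeta> simp: norm_pow_def norm2_nonneg\<close>)
  qed (intro L2_op_pow L2_\<zeta> assms)
  also have "\<dots> = norm_pow I K (j - 1) * norm1 I \<xi>0
      + norm2 I \<xi> * (\<Sum>l<j - 1. norm_pow I K l * norm1 I (op_pow I K (j - l - 1) b))"
    by (simp add: sum_distrib_left mult_ac)
  finally show ?thesis .
qed

text \<open>Split off the summand \<open>k = 0\<close>, which is \<open>\<zeta>\<close> of index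
  \<open>Suc j\<close>, that is, \<open>\<xi>\<close> applied to the current iterate of
  \<open>b\<close>. Every other summand is \<open>K\<close> applied to the summand before it in the
  shorter sum.\<close>

lemma \<xi>_term_Suc_Suc:
  assumes K: "L2_kernel K" and \<xi>: "L2_kernel \<xi>" and b: "L2_fun b" and \<xi>0: "L2_fun \<xi>0"
  shows "AE t in lebesgue_on I. \<xi>_term I K b \<xi> \<xi>0 (Suc (Suc j)) t
    = int_op I K (\<xi>_term I K b \<xi> \<xi>0 (Suc j)) t + int_op I \<xi> (op_pow I K (Suc j) b) t"
proof -
  let ?z = "\<lambda>k. op_pow I K k (\<zeta> I K b \<xi> (Suc j - k - 1))"
  have z: "L2_fun (?z k)" for k
    by (intro L2_op_pow L2_\<zeta> assms)
  have "AE t in lebesgue_on I. int_op I K (\<lambda>t. op_pow I K j \<xi>0 t + (\<Sum>k<j. ?z k t)) t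
    = int_op I K (op_pow I K j \<xi>0) t + int_op I K (\<lambda>t. \<Sum>k<j. ?z k t) t"
    by (intro int_op_add K L2_op_pow \<xi>0 sq_integrable_sum z)
  moreover have "AE t in lebesgue_on I. int_op I K (\<lambda>t. \<Sum>k<j. ?z k t) t = (\<Sum>k<j. int_op I K (?z k) t)"
    by (intro int_op_sum K z) simp
  ultimately show ?thesis
  proof eventually_elim
    case (elim t)
    then show ?case
      by (simp add: \<xi>_term_def[abs_def] sum.lessThan_Suc_shift op_pow_Suc op_pow_0 \<zeta>_def int_op_def[of _ \<xi>]
          del: sum.lessThan_Suc)
  qed
qed

end

text \<open>A discrete Gronwall estimate: the input \<open>x k\<close> enters at index
  \<open>k + 1\<close> and is multiplied by \<open>r\<close> in each of the \<open>j - k - 1\<close>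
  steps that remain up to \<open>j\<close>.\<close>

lemma linear_recursion_bound:
  fixes e x :: "nat \<Rightarrow> real"
  assumes "0 \<le> r" "e 1 \<le> e0"
    and step: "\<And>j. j \<ge> 1 \<Longrightarrow> e (Suc j) \<le> r * e j + x j"
    and "j \<ge> 1"
  shows "e j \<le> r ^ (j - 1) * e0 + (\<Sum>k=1..j - 1. r ^ (j - k - 1) * x k)"
  using \<open>j \<ge> 1\<close>
proof (induction j rule: nat_induct_at_least)
  case base
  then show ?case using assms(2) by simp
next
  case (Suc j)
  then obtain i where j: "j = Suc i" by (cases j) auto
  have "e (Suc j) \<le> r * (r ^ (j - 1) * e0 + (\<Sum>k=1..j - 1. r ^ (j - k - 1) * x k)) + x j"
    using step[OF Suc.hyps] mult_left_mono[OF Suc.IH \<open>0 \<le> r\<close>] by linarith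
  also have "r * (\<Sum>k=1..j - 1. r ^ (j - k - 1) * x k) = (\<Sum>k=1..i. r ^ (Suc j - k - 1) * x k)"
    unfolding sum_distrib_left j
    by (intro sum.cong) (auto simp: Suc_diff_le simp flip: power_Suc mult.assoc)
  then have "r * (r ^ (j - 1) * e0 + (\<Sum>k=1..j - 1. r ^ (j - k - 1) * x k)) + x j
      = r ^ (Suc j - 1) * e0 + (\<Sum>k=1..Suc j - 1. r ^ (Suc j - k - 1) * x k)"
    by (simp add: j distrib_left mult.assoc)
  finally show ?case .
qed

section \<open>The remainder of the iterated estimator, for fixed kernels\<close>

context lmeasurable_set
begin

text \<open>The argument at one outcome: \<open>H\<close> stands for the realised
  \<open>K_hat\<close>, \<open>g\<close> for \<open>K_hat1_b\<close>, and \<open>e\<close> for the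
  remainder. The decomposition of \<open>H\<close> is required only on \<open>I\<close>, because the
  sample is uncontrolled elsewhere.\<close>

lemma iterate_remainder:
  fixes K \<xi> \<eta> H :: "real \<Rightarrow> real \<Rightarrow> real" and b \<xi>0 \<eta>0 g :: "real \<Rightarrow> real" and n :: nat
  defines "e \<equiv> \<lambda>j t. real n * ((int_op I H ^^ (j - 1)) g t - op_pow I K j b t
      - \<xi>_term I K b \<xi> \<xi>0 j t / sqrt (real n))"
  assumes n: "n \<ge> 1"
    and K: "L2_kernel K" and \<xi>: "L2_kernel \<xi>" and \<eta>: "L2_kernel \<eta>"
    and b: "L2_fun b" and \<xi>0: "L2_fun \<xi>0" and \<eta>0: "L2_fun \<eta>0"
    and H: "\<And>s t. s \<in> I \<Longrightarrow> t \<in> I \<Longrightarrow> H s t = K s t + \<xi> s t / sqrt (real n) + \<eta> s t / real n"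
    and g_meas: "g \<in> borel_measurable (lebesgue_on I)"
    and g: "AE t in lebesgue_on I. g t = int_op I K b t + \<xi>0 t / sqrt (real n) + \<eta>0 t / real n"
  shows L2_iterate_remainder: "L2_fun (e (Suc j))"
    and norm1_iterate_remainder_le: "j \<ge> 1 \<Longrightarrow> norm1 I (e j) \<le> R1 I n K \<xi> \<eta> ^ (j - 1) * norm1 I \<eta>0
          + R2 I \<xi> \<eta> *
              (\<Sum>k=1..j - 1. R1 I n K \<xi> \<eta> ^ (j - k - 1) *
                 (norm1 I (op_pow I K k b) + norm_pow I K (k - 1) * norm1 I \<xi>0))
          + R2 I \<xi> \<eta> * norm2 I \<xi> *
              (\<Sum>k=1..j - 1. R1 I n K \<xi> \<eta> ^ (j - k - 1) *
                 (\<Sum>l<k - 1. norm_pow I K l * norm1 I (op_pow I K (k - l - 1) b)))"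
proof -
  define q where "q = 1 / sqrt (real n)"
  have q: "q > 0" "q \<le> 1" and n_q: "1 / real n = q * q" "real n * (q * q) = 1"
    using n by (simp_all add: q_def field_simps)
  \<comment> \<open>\<open>H'\<close> agrees with \<open>H\<close> on the square of \<open>I\<close>
    but is literally a sum of L2 kernels, so the additivity and triangle lemmas apply. Writing
    \<open>q * q\<close> for \<open>1 / n\<close> leaves polynomial identities in
    \<open>q\<close>.\<close>
  define H' where "H' = (\<lambda>s t. K s t + (q * \<xi> s t + (q * q) * \<eta> s t))"
  define S where "S = (\<lambda>s t. \<xi> s t + q * \<eta> s t)"
  define x where "x = \<xi>_term I K b \<xi> \<xi>0"
  define F where "F j = (int_op I H ^^ j) g" for j
  have H': "L2_kernel H'" and S: "L2_kernel S"
    unfolding H'_def S_def by (intro L2_kernel_add L2_kernel_cmult K \<xi> \<eta>)+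
  have x: "L2_fun (x j)" for j
    unfolding x_def by (intro L2_\<xi>_term K \<xi> b \<xi>0)
  have Kb: "L2_fun (op_pow I K j b)" for j
    by (intro L2_op_pow K b)
  have H_eq: "int_op I H f t = int_op I H' f t" if "t \<in> I" for f t
    unfolding int_op_def
  proof (intro Bochner_Integration.integral_cong refl)
    fix s assume "s \<in> space (lebesgue_on I)"
    then have "s \<in> I" by simp
    then show "f s * H s t = f s * H' s t"
      using H[of s t] that n_q(1) by (simp add: H'_def q_def)
  qed
  have F_L2: "L2_fun (F j)" for j
  proof (induction j)
    case 0
    have "L2_fun (\<lambda>t. int_op I K b t + \<xi>0 t / sqrt (real n) + \<eta>0 t / real n)"
      by (intro sq_integrable_add sq_integrable_divide L2_int_op K b \<xi>0 \<eta>0)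
    then show ?case
      unfolding F_def by (rule sq_integrable_cong_AE) (use g g_meas in auto)
  next
    case (Suc j)
    have "L2_fun (int_op I H' (F j))" by (intro L2_int_op H' Suc)
    then show ?case
      using sq_integrable_cong[of "lebesgue_on I" "F (Suc j)" "int_op I H' (F j)"] H_eq
      by (simp add: F_def)
  qed
  have e_eq: "e (Suc j) t = real n * (F j t - op_pow I K (Suc j) b t - q * x (Suc j) t)" for j t
    by (simp add: e_def F_def x_def q_def)
  have e_L2: "L2_fun (e (Suc j))" for j
    unfolding e_eq[abs_def] by (intro sq_integrable_cmult sq_integrable_diff F_L2 Kb x)
  then show "L2_fun (e (Suc j))" .
  have F_eq: "F j = (\<lambda>t. op_pow I K (Suc j) b t + (q * x (Suc j) t + q * q * e (Suc j) t))" for j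
  proof
    fix t
    have "q * q * e (Suc j) t = (real n * (q * q)) * (F j t - op_pow I K (Suc j) b t - q * x (Suc j) t)"
      by (simp add: e_eq)
    then show "F j t = op_pow I K (Suc j) b t + (q * x (Suc j) t + q * q * e (Suc j) t)"
      by (simp add: n_q)
  qed
  have step: "AE t in lebesgue_on I. e (Suc (Suc j)) t
      = int_op I H' (e (Suc j)) t + (int_op I S (x (Suc j)) t + int_op I \<eta> (op_pow I K (Suc j) b) t)" for j
  proof -
    let ?b = "op_pow I K (Suc j) b" and ?x = "x (Suc j)" and ?e = "e (Suc j)"
    have H'_apply: "AE t in lebesgue_on I. int_op I H' f t
        = int_op I K f t + (q * int_op I \<xi> f t + q * q * int_op I \<eta> f t)" if f: "L2_fun f" for f
      using int_op_kernel_add[OF K L2_kernel_add[OF L2_kernel_cmult[OF \<xi>] L2_kernel_cmult[OF \<eta>]] f, of q "q * q"]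
        int_op_kernel_add[OF L2_kernel_cmult[OF \<xi>] L2_kernel_cmult[OF \<eta>] f, of q "q * q"]
      by eventually_elim (simp add: H'_def int_op_kernel_cmult)
    have S_apply: "AE t in lebesgue_on I. int_op I S ?x t = int_op I \<xi> ?x t + q * int_op I \<eta> ?x t"
      using int_op_kernel_add[OF \<xi> L2_kernel_cmult[OF \<eta>] x, of q "Suc j"]
      by eventually_elim (simp add: S_def int_op_kernel_cmult)
    have "AE t in lebesgue_on I. int_op I H' (F j) t
        = int_op I H' ?b t + int_op I H' (\<lambda>t. q * ?x t + q * q * ?e t) t"
      unfolding F_eq by (intro int_op_add H' Kb sq_integrable_add sq_integrable_cmult x e_L2)
    moreover have "AE t in lebesgue_on I. int_op I H' (\<lambda>t. q * ?x t + q * q * ?e t) t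
        = int_op I H' (\<lambda>t. q * ?x t) t + int_op I H' (\<lambda>t. q * q * ?e t) t"
      by (intro int_op_add H' sq_integrable_cmult x e_L2)
    moreover have "AE t in lebesgue_on I. x (Suc (Suc j)) t = int_op I K ?x t + int_op I \<xi> ?b t"
      unfolding x_def by (intro \<xi>_term_Suc_Suc K \<xi> b \<xi>0)
    ultimately show ?thesis
      using AE_space S_apply H'_apply[OF Kb[of "Suc j"]] H'_apply[OF x[of "Suc j"]]
    proof eventually_elim
      case (elim t)
      \<comment> \<open>The terms of order 1 and \<open>q\<close> in \<open>H'\<close> applied to
        \<open>F j\<close> cancel against the next iterate of \<open>b\<close> and the next
        \<open>x\<close>. All that is left carries the factor \<open>q * q\<close>, which
        \<open>real n\<close> removes.\<close>
      let ?w = "int_op I H' ?e t + (int_op I \<xi> ?x t + q * int_op I \<eta> ?x t + int_op I \<eta> ?b t)"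
      have "F (Suc j) t - op_pow I K (Suc (Suc j)) b t - q * x (Suc (Suc j)) t = q * q * ?w"
        using elim H_eq[of t "F j"]
        by (simp add: F_def op_pow_Suc[of _ _ "Suc j"] int_op_cmult algebra_simps)
      then have "e (Suc (Suc j)) t = (real n * (q * q)) * ?w"
        unfolding e_eq by simp
      then show ?case using elim by (simp add: n_q)
    qed
  qed
  have nH': "norm2 I H' \<le> R1 I n K \<xi> \<eta>"
  proof -
    have "norm2 I H' \<le> norm2 I K + norm2 I (\<lambda>s t. q * \<xi> s t + q * q * \<eta> s t)"
      unfolding H'_def by (intro norm2_triangle L2_kernel_add L2_kernel_cmult K \<xi> \<eta>)
    also have "norm2 I (\<lambda>s t. q * \<xi> s t + q * q * \<eta> s t)
        \<le> norm2 I (\<lambda>s t. q * \<xi> s t) + norm2 I (\<lambda>s t. q * q * \<eta> s t)"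
      by (intro norm2_triangle L2_kernel_add L2_kernel_cmult \<xi> \<eta>)
    also have "\<dots> = norm2 I \<xi> / sqrt (real n) + norm2 I \<eta> / real n"
      unfolding norm2_cmult n_q(1)[symmetric] by (simp add: q_def)
    finally show ?thesis by (simp add: R1_def)
  qed
  have nS: "norm2 I S \<le> R2 I \<xi> \<eta>"
  proof -
    have "norm2 I S \<le> norm2 I \<xi> + norm2 I (\<lambda>s t. q * \<eta> s t)"
      unfolding S_def by (intro norm2_triangle L2_kernel_cmult \<xi> \<eta>)
    \<comment> \<open>Dropping \<open>q\<close> costs nothing in the direction needed, since
      \<open>n \<ge> 1\<close> gives \<open>q \<le> 1\<close>.\<close>
    also have "norm2 I (\<lambda>s t. q * \<eta> s t) \<le> 1 * norm2 I \<eta>"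
      unfolding norm2_cmult using q by (intro mult_right_mono) (auto simp: norm2_nonneg)
    finally show ?thesis by (simp add: R2_def)
  qed
  have nR: "norm2 I \<eta> \<le> R2 I \<xi> \<eta>" "0 \<le> R2 I \<xi> \<eta>" "0 \<le> R1 I n K \<xi> \<eta>"
    by (simp_all add: R1_def R2_def norm2_nonneg)
  define B where "B k = norm1 I (op_pow I K k b)" for k
  define C where "C k = norm_pow I K (k - 1) * norm1 I \<xi>0" for k
  define D where "D k = (\<Sum>l<k - 1. norm_pow I K l * norm1 I (op_pow I K (k - l - 1) b))" for k
  have nx: "norm1 I (x k) \<le> C k + norm2 I \<xi> * D k" for k
    unfolding x_def C_def D_def by (intro norm1_\<xi>_term_le K \<xi> b \<xi>0)
  show "norm1 I (e j) \<le> R1 I n K \<xi> \<eta> ^ (j - 1) * norm1 I \<eta>0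
          + R2 I \<xi> \<eta> *
              (\<Sum>k=1..j - 1. R1 I n K \<xi> \<eta> ^ (j - k - 1) *
                 (norm1 I (op_pow I K k b) + norm_pow I K (k - 1) * norm1 I \<xi>0))
          + R2 I \<xi> \<eta> * norm2 I \<xi> *
              (\<Sum>k=1..j - 1. R1 I n K \<xi> \<eta> ^ (j - k - 1) *
                 (\<Sum>l<k - 1. norm_pow I K l * norm1 I (op_pow I K (k - l - 1) b)))"
    if "j \<ge> 1"
  proof -
    let ?r = "R1 I n K \<xi> \<eta>" and ?R = "R2 I \<xi> \<eta>"
    let ?y = "\<lambda>k. ?R * (B k + C k) + ?R * norm2 I \<xi> * D k"
    \<comment> \<open>Base of the recursion: at index 1 the sum in \<open>\<xi>_term\<close> is
      empty, so the expansion of \<open>g\<close> says that the remainder is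
      \<open>\<eta>0\<close>.\<close>
    have "norm1 I (e 1) = norm1 I \<eta>0"
    proof (intro norm1_cong_AE)
      show "e 1 \<in> borel_measurable (lebesgue_on I)" "\<eta>0 \<in> borel_measurable (lebesgue_on I)"
        using e_L2[of 0] \<eta>0 by (auto dest: sq_integrable_measurable)
      show "AE t in lebesgue_on I. e 1 t = \<eta>0 t"
        using g by eventually_elim (use n in \<open>simp add: e_def op_pow_def \<xi>_term_def\<close>)
    qed
    moreover have "norm1 I (e (Suc k)) \<le> ?r * norm1 I (e k) + ?y k" if "k \<ge> 1" for k
    proof -
      from that obtain i where k: "k = Suc i" by (cases k) auto
      have eL2: "L2_fun (e k)" using e_L2[of i] by (simp add: k)
      have "norm1 I (e (Suc k)) = norm1 I (\<lambda>t. int_op I H' (e k) t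
          + (int_op I S (x k) t + int_op I \<eta> (op_pow I K k b) t))"
        using step[of i] unfolding k
        by (intro norm1_cong_AE)
           (intro sq_integrable_measurable sq_integrable_add L2_int_op e_L2 H' S \<eta> x Kb | assumption)+
      also have "\<dots> \<le> norm1 I (int_op I H' (e k))
          + norm1 I (\<lambda>t. int_op I S (x k) t + int_op I \<eta> (op_pow I K k b) t)"
        by (intro norm1_triangle sq_integrable_add L2_int_op eL2 H' S \<eta> x Kb)
      also have "norm1 I (\<lambda>t. int_op I S (x k) t + int_op I \<eta> (op_pow I K k b) t)
          \<le> norm1 I (int_op I S (x k)) + norm1 I (int_op I \<eta> (op_pow I K k b))"
        by (intro norm1_triangle L2_int_op S \<eta> x Kb)
      also have "norm1 I (int_op I H' (e k)) + (norm1 I (int_op I S (x k)) + norm1 I (int_op I \<eta> (op_pow I K k b)))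
          \<le> norm2 I H' * norm1 I (e k) + (norm2 I S * norm1 I (x k) + norm2 I \<eta> * B k)"
        unfolding B_def by (intro add_mono norm1_int_op_le H' S \<eta> x eL2 Kb)
      \<comment> \<open>The norms of \<open>S\<close> and of \<open>\<eta>\<close> are both raised
        to \<open>R2\<close>, which therefore becomes a common factor of the two sums in the
        bound.\<close>
      also have "\<dots> \<le> ?r * norm1 I (e k) + (?R * norm1 I (x k) + ?R * B k)"
        by (intro add_mono mult_right_mono nH' nS nR) (simp_all add: norm1_nonneg B_def)
      also have "?R * norm1 I (x k) \<le> ?R * (C k + norm2 I \<xi> * D k)"
        by (intro mult_left_mono nx nR)
      finally show ?thesis by (simp add: algebra_simps)
    qed
    ultimately have "norm1 I (e j) \<le> ?r ^ (j - 1) * norm1 I \<eta>0 + (\<Sum>k=1..j - 1. ?r ^ (j - k - 1) * ?y k)"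
      using that nR by (intro linear_recursion_bound) auto
    also have "(\<Sum>k=1..j - 1. ?r ^ (j - k - 1) * ?y k)
      = ?R * (\<Sum>k=1..j - 1. ?r ^ (j - k - 1) * (B k + C k))
        + ?R * norm2 I \<xi> * (\<Sum>k=1..j - 1. ?r ^ (j - k - 1) * D k)"
      unfolding sum_distrib_left sum.distrib[symmetric]
      by (intro sum.cong refl) (simp add: algebra_simps)
    finally show ?thesis
      by (simp add: B_def C_def D_def add.assoc)
  qed
qed

end

section \<open>Square-integrable processes\<close>

lemma random_functionD:
  assumes "random_function M I X"
  shows random_function_pair_measurable: "(\<lambda>(\<omega>, t). X \<omega> t) \<in> borel_measurable (M \<Otimes>\<^sub>M lebesgue_on I)"
    and random_function_measurable_at: "t \<in> I \<Longrightarrow> (\<lambda>\<omega>. X \<omega> t) \<in> borel_measurable M"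
    and random_function_restrict: "(\<lambda>\<omega>. restrict (X \<omega>) I) \<in> measurable M (path_space I)"
proof -
  show *[measurable]: "(\<lambda>(\<omega>, t). X \<omega> t) \<in> borel_measurable (M \<Otimes>\<^sub>M lebesgue_on I)"
    using assms by (simp add: random_function_def)
  show at: "(\<lambda>\<omega>. X \<omega> t) \<in> borel_measurable M" if "t \<in> I" for t
    using measurable_Pair1[OF *, of t] that by simp
  show "(\<lambda>\<omega>. restrict (X \<omega>) I) \<in> measurable M (path_space I)"
    unfolding path_space_def by (intro measurable_restrict at)
qed

text \<open>Both integrals are integrals of \<open>g\<close> against the common law. Only
  measurability of \<open>g\<close> is asked for: if one side is not integrable, neither is the
  other, and both Bochner integrals are 0.\<close>

lemma same_distr_pair:
  assumes X: "random_function M I X" "random_function M I X'"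
    and Y: "Y \<in> borel_measurable M" "Y' \<in> borel_measurable M"
    and D: "distr M (path_space I \<Otimes>\<^sub>M borel) (\<lambda>\<omega>. (restrict (X' \<omega>) I, Y' \<omega>)) =
        distr M (path_space I \<Otimes>\<^sub>M borel) (\<lambda>\<omega>. (restrict (X \<omega>) I, Y \<omega>))"
    and g: "g \<in> borel_measurable (path_space I \<Otimes>\<^sub>M borel)"
  shows same_distr_integral:
      "(LINT \<omega>|M. g (restrict (X' \<omega>) I, Y' \<omega>)) = (LINT \<omega>|M. g (restrict (X \<omega>) I, Y \<omega>) :: real)"
    and same_distr_integrable:
      "integrable M (\<lambda>\<omega>. g (restrict (X' \<omega>) I, Y' \<omega>)) \<longleftrightarrow> integrable M (\<lambda>\<omega>. g (restrict (X \<omega>) I, Y \<omega>))"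
proof -
  note [measurable] = X[THEN random_function_restrict] Y g
  have "(\<lambda>\<omega>. (restrict (X' \<omega>) I, Y' \<omega>)) \<in> measurable M (path_space I \<Otimes>\<^sub>M borel)"
    "(\<lambda>\<omega>. (restrict (X \<omega>) I, Y \<omega>)) \<in> measurable M (path_space I \<Otimes>\<^sub>M borel)"
    by measurable
  note * = integral_distr[OF this(1) g] integral_distr[OF this(2) g]
    integrable_distr_eq[OF this(1) g] integrable_distr_eq[OF this(2) g]
  show "(LINT \<omega>|M. g (restrict (X' \<omega>) I, Y' \<omega>)) = (LINT \<omega>|M. g (restrict (X \<omega>) I, Y \<omega>))"
    using * D by simp
  show "integrable M (\<lambda>\<omega>. g (restrict (X' \<omega>) I, Y' \<omega>)) \<longleftrightarrow> integrable M (\<lambda>\<omega>. g (restrict (X \<omega>) I, Y \<omega>))"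
    using * D by simp
qed

text \<open>Stated for the nonnegative integral because the second moment may be infinite at
  exceptional \<open>t\<close>.\<close>

lemma same_distr_nn_integral_sq:
  assumes X: "random_function M I X" "random_function M I X'"
    and Y: "Y \<in> borel_measurable M" "Y' \<in> borel_measurable M"
    and D: "distr M (path_space I \<Otimes>\<^sub>M borel) (\<lambda>\<omega>. (restrict (X' \<omega>) I, Y' \<omega>)) =
        distr M (path_space I \<Otimes>\<^sub>M borel) (\<lambda>\<omega>. (restrict (X \<omega>) I, Y \<omega>))"
    and t: "t \<in> I"
  shows "(\<integral>\<^sup>+ \<omega>. ennreal ((X' \<omega> t)\<^sup>2) \<partial>M) = (\<integral>\<^sup>+ \<omega>. ennreal ((X \<omega> t)\<^sup>2) \<partial>M)"
proof -
  note [measurable] = X[THEN random_function_restrict] Y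
  let ?g = "\<lambda>p. ennreal ((fst p t)\<^sup>2)"
  have [measurable]: "(\<lambda>x. x t) \<in> borel_measurable (path_space I)"
    unfolding path_space_def using t by measurable
  have "(\<integral>\<^sup>+ \<omega>. ?g (restrict (X' \<omega>) I, Y' \<omega>) \<partial>M) = (\<integral>\<^sup>+ \<omega>. ?g (restrict (X \<omega>) I, Y \<omega>) \<partial>M)"
    using arg_cong[OF D, of "\<lambda>N. integral\<^sup>N N ?g"] by (simp add: nn_integral_distr)
  then show ?thesis using t by simp
qed

text \<open>Both centrings, at the sample means and at \<open>m\<close> and \<open>l\<close>, are
  instances of one expansion with free centres. The correction term is the origin of
  \<open>\<eta>\<close> and \<open>\<eta>0\<close>.\<close>

lemma sample_covariance:
  fixes x y :: "nat \<Rightarrow> real"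
  assumes "n \<ge> 1"
  shows "(\<Sum>i=1..n. (x i - (\<Sum>i=1..n. x i) / n) * (y i - (\<Sum>i=1..n. y i) / n)) / n
    = (\<Sum>i=1..n. (x i - m) * (y i - l)) / n
      - ((\<Sum>i=1..n. x i) / n - m) * ((\<Sum>i=1..n. y i) / n - l)"
proof -
  let ?s = "\<Sum>i=1..n. x i" and ?t = "\<Sum>i=1..n. y i"
  have *: "(\<Sum>i=1..n. (x i - u) * (y i - v)) = (\<Sum>i=1..n. x i * y i) - v * ?s - u * ?t + n * (u * v)"
    for u v :: real
    by (simp add: left_diff_distrib right_diff_distrib sum_subtractf sum_distrib_left mult_ac)
  show ?thesis unfolding * using assms by (simp add: field_simps)
qed

section \<open>Joint measurability of operators with random kernels\<close>

context lmeasurable_set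
begin

lemma random_function_const: "f \<in> borel_measurable (lebesgue_on I) \<Longrightarrow> random_function M I (\<lambda>_. f)"
  unfolding random_function_def case_prod_unfold by (rule measurable_compose[OF measurable_snd])

lemma random_function_int_op:
  assumes "(\<lambda>(\<omega>, s, t). L \<omega> s t) \<in> borel_measurable (M \<Otimes>\<^sub>M (lebesgue_on I \<Otimes>\<^sub>M lebesgue_on I))"
    and "random_function M I F"
  shows "random_function M I (\<lambda>\<omega>. int_op I (L \<omega>) (F \<omega>))"
proof -
  note [measurable] = random_function_pair_measurable[OF assms(2)]
  \<comment> \<open>Reorders the variables so that \<open>s\<close>, which is integrated out, comes
    last and the outcome and \<open>t\<close> are parameters.\<close>
  have "(\<lambda>p. (fst (fst p), snd p, snd (fst p))) \<in> measurable ((M \<Otimes>\<^sub>M lebesgue_on I) \<Otimes>\<^sub>M lebesgue_on I)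
      (M \<Otimes>\<^sub>M (lebesgue_on I \<Otimes>\<^sub>M lebesgue_on I))"
    by measurable
  from measurable_compose[OF this assms(1)]
  have [measurable]: "(\<lambda>p. L (fst (fst p)) (snd p) (snd (fst p)))
      \<in> borel_measurable ((M \<Otimes>\<^sub>M lebesgue_on I) \<Otimes>\<^sub>M lebesgue_on I)"
    by simp
  show ?thesis unfolding random_function_def int_op_def by measurable
qed

lemma random_function_op_pow:
  assumes "(\<lambda>(s, t). L s t) \<in> borel_measurable (lebesgue_on I \<Otimes>\<^sub>M lebesgue_on I)"
    and "random_function M I F"
  shows "random_function M I (\<lambda>\<omega>. op_pow I L j (F \<omega>))"
proof (induction j)
  case (Suc j)
  note [measurable] = assms(1)
  show ?case unfolding op_pow_Suc by (intro random_function_int_op Suc) measurable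
qed (simp add: op_pow_0 assms)

lemma random_function_int_op_pow:
  assumes "(\<lambda>(\<omega>, s, t). L \<omega> s t) \<in> borel_measurable (M \<Otimes>\<^sub>M (lebesgue_on I \<Otimes>\<^sub>M lebesgue_on I))"
    and "random_function M I F"
  shows "random_function M I (\<lambda>\<omega>. (int_op I (L \<omega>) ^^ j) (F \<omega>))"
  by (induction j) (auto intro: random_function_int_op assms)

end

text \<open>The moment condition uses nonnegative integrals, since a Bochner integral would read an
  infinite moment as 0. The locale is applied to \<open>X\<close> and to each sample
  process.\<close>

locale L2_process = lmeasurable_set I + prob_space M
  for I :: "real set" and M :: "'w measure" +
  fixes X :: "'w \<Rightarrow> real \<Rightarrow> real"
  assumes process: "random_function M I X"
    and nn_integral_process_sq: "(\<integral>\<^sup>+ t. (\<integral>\<^sup>+ \<omega>. ennreal ((X \<omega> t)\<^sup>2) \<partial>M) \<partial>lebesgue_on I) < \<infinity>"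
begin

sublocale pair: pair_sigma_finite M "lebesgue_on I" ..

abbreviation centred :: "'w \<Rightarrow> real \<Rightarrow> real" where
  "centred \<omega> t \<equiv> X \<omega> t - mean_fun M X t"

lemmas sigma_finite_M = sigma_finite_measure_axioms
lemmas sigma_finite_I = domain.sigma_finite_measure_axioms

lemma L2_process: "sq_integrable (M \<Otimes>\<^sub>M lebesgue_on I) (\<lambda>(\<omega>, t). X \<omega> t)"
proof -
  note [measurable] = random_function_pair_measurable[OF process]
  have "(\<integral>\<^sup>+ p. ennreal (norm ((case p of (\<omega>, t) \<Rightarrow> X \<omega> t)\<^sup>2)) \<partial>(M \<Otimes>\<^sub>M lebesgue_on I))
      = (\<integral>\<^sup>+ t. (\<integral>\<^sup>+ \<omega>. ennreal ((X \<omega> t)\<^sup>2) \<partial>M) \<partial>lebesgue_on I)"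
    by (subst pair.nn_integral_snd[symmetric]) simp_all
  then have "integrable (M \<Otimes>\<^sub>M lebesgue_on I) (\<lambda>p. (case p of (\<omega>, t) \<Rightarrow> X \<omega> t)\<^sup>2)"
    using nn_integral_process_sq by (intro integrableI_bounded) simp_all
  then show ?thesis by (simp add: sq_integrable_def)
qed

text \<open>The mean is the process, seen as a kernel, applied to the constant 1 on the probability
  space.\<close>

lemma L2_mean_fun: "L2_fun (mean_fun M X)"
  using sq_integrable_kernel_apply[OF sigma_finite_M sigma_finite_I sq_integrable_const[of 1] L2_process]
  by (simp add: mean_fun_def[abs_def])

lemma L2_centred: "sq_integrable (M \<Otimes>\<^sub>M lebesgue_on I) (\<lambda>(\<omega>, t). centred \<omega> t)"
  using sq_integrable_diff[OF L2_process
      sq_integrable_tensor[OF sigma_finite_M sigma_finite_I sq_integrable_const[of 1] L2_mean_fun]]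
  by (simp add: case_prod_unfold)

lemma AE_L2_paths: "AE \<omega> in M. L2_fun (X \<omega>)"
  by (rule sq_integrable_section_fst[OF sigma_finite_M sigma_finite_I L2_process])

text \<open>The covariance is the composition of the centred process with its own transpose, with
  the outcome as the middle variable.\<close>

lemma L2_cov_kernel: "L2_kernel (cov_kernel M X)"
  using sq_integrable_kernel_comp[OF sigma_finite_I sigma_finite_M sigma_finite_I
      sq_integrable_swap[OF sigma_finite_M sigma_finite_I L2_centred] L2_centred]
  by (simp add: cov_kernel_def[abs_def])

lemma subalgebra_sigma_gen: "subalgebra M (sigma_gen M I X)"
  unfolding subalgebra_def sigma_gen_def
  using sets_image_in_sets[OF refl random_function_restrict[OF process]] by simp

lemma measurable_at_sigma_gen:
  assumes "t \<in> I"
  shows "(\<lambda>\<omega>. X \<omega> t) \<in> borel_measurable (sigma_gen M I X)"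
proof -
  have "(\<lambda>\<omega>. restrict (X \<omega>) I) \<in> measurable (sigma_gen M I X) (path_space I)"
    unfolding sigma_gen_def
    using measurable_space[OF random_function_restrict[OF process]] by (intro measurable_vimage_algebra1) auto
  then have "(\<lambda>\<omega>. restrict (X \<omega>) I t) \<in> borel_measurable (sigma_gen M I X)"
    unfolding path_space_def using assms by (rule measurable_compose[OF _ measurable_component_singleton])
  then show ?thesis using assms by simp
qed

text \<open>The centred value at \<open>t\<close> is measurable for the sigma-algebra of
  \<open>X\<close>, so under the integral the error may be replaced by its conditional expectation,
  which is 0. The second moment at \<open>t\<close> makes the product integrable.\<close>

lemma covariance_with_error:
  assumes \<epsilon>: "sq_integrable M \<epsilon>"
    and cond: "AE \<omega> in M. real_cond_exp M (sigma_gen M I X) \<epsilon> \<omega> = 0"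
    and t: "t \<in> I" "sq_integrable M (\<lambda>\<omega>. centred \<omega> t)"
  shows "(LINT \<omega>|M. centred \<omega> t * \<epsilon> \<omega>) = 0"
proof -
  interpret finite_measure_subalgebra M "sigma_gen M I X"
    by unfold_locales (rule subalgebra_sigma_gen)
  have "(LINT \<omega>|M. centred \<omega> t * \<epsilon> \<omega>)
      = (LINT \<omega>|M. centred \<omega> t * real_cond_exp M (sigma_gen M I X) \<epsilon> \<omega>)"
    using measurable_at_sigma_gen[OF t(1)] sq_integrable_measurable[OF \<epsilon>]
    by (intro real_cond_exp_intg(2)[symmetric] integrable_mult_sq t \<epsilon>) auto
  also have "\<dots> = (LINT \<omega>|M. 0)"
    using cond sq_integrable_measurable[OF t(2)]
    by (intro integral_cong_AE) (auto intro!: borel_measurable_times borel_measurable_cond_exp2)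
  finally show ?thesis by simp
qed

section \<open>The response of the linear model and its covariance with the process\<close>

context
  fixes a :: real and b :: "real \<Rightarrow> real" and Y \<epsilon> :: "'w \<Rightarrow> real"
  assumes b: "L2_fun b" and \<epsilon>: "sq_integrable M \<epsilon>"
    and Y: "Y \<in> borel_measurable M"
    and Y_eq: "AE \<omega> in M. Y \<omega> = a + (LINT t|lebesgue_on I. b t * X \<omega> t) + \<epsilon> \<omega>"
begin

text \<open>The regression integral is the process with its two variables swapped, used as a kernel
  from L2 of the interval to L2 of the probability space.\<close>

lemma L2_response: "sq_integrable M Y"
proof -
  have "sq_integrable M (\<lambda>\<omega>. LINT t|lebesgue_on I. b t * X \<omega> t)"
    by (rule sq_integrable_kernel_apply[OF sigma_finite_I sigma_finite_M b
        sq_integrable_swap[OF sigma_finite_M sigma_finite_I L2_process]])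
  then have "sq_integrable M (\<lambda>\<omega>. a + (LINT t|lebesgue_on I. b t * X \<omega> t) + \<epsilon> \<omega>)"
    by (intro sq_integrable_add sq_integrable_const \<epsilon>)
  then show ?thesis
    by (rule sq_integrable_cong_AE) (use Y Y_eq in auto)
qed

lemma L2_response_covariance: "L2_fun (\<lambda>t. LINT \<omega>|M. centred \<omega> t * (Y \<omega> - (LINT \<omega>|M. Y \<omega>)))"
  using sq_integrable_kernel_apply[OF sigma_finite_M sigma_finite_I
      sq_integrable_diff[OF L2_response sq_integrable_const] L2_centred]
  by (simp add: mult.commute)

lemma response_covariance:
  assumes cond: "AE \<omega> in M. real_cond_exp M (sigma_gen M I X) \<epsilon> \<omega> = 0"
  shows "AE t in lebesgue_on I.
    (LINT \<omega>|M. centred \<omega> t * (Y \<omega> - (LINT \<omega>|M. Y \<omega>))) = int_op I (cov_kernel M X) b t"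
proof -
  define W where "W \<omega> = (LINT t|lebesgue_on I. b t * centred \<omega> t)" for \<omega>
  \<comment> \<open>\<open>c\<close> collects the deterministic part of \<open>Y\<close>. The
    difference between \<open>c\<close> and the mean of \<open>Y\<close> need not be evaluated, as
    it will multiply the mean of a centred variable.\<close>
  define c where "c = a + (LINT t|lebesgue_on I. b t * mean_fun M X t)"
  have W: "sq_integrable M W"
    unfolding W_def[abs_def]
    by (rule sq_integrable_kernel_apply[OF sigma_finite_I sigma_finite_M b
        sq_integrable_swap[OF sigma_finite_M sigma_finite_I L2_centred]])
  have "AE \<omega> in M. (LINT t|lebesgue_on I. b t * X \<omega> t)
      = W \<omega> + (LINT t|lebesgue_on I. b t * mean_fun M X t)"
    using AE_L2_paths
  proof eventually_elim
    case (elim \<omega>)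
    then show ?case
      using integrable_mult_sq[OF b elim] integrable_mult_sq[OF b L2_mean_fun]
      by (simp add: W_def right_diff_distrib)
  qed
  with Y_eq have c: "AE \<omega> in M. Y \<omega> = c + W \<omega> + \<epsilon> \<omega>"
    by eventually_elim (simp add: c_def)
  \<comment> \<open>Fubini, as \<open>kernel_apply_assoc\<close> with the probability space in the
    middle: the inner integral on the right is the covariance kernel.\<close>
  have "AE t in lebesgue_on I. (LINT \<omega>|M. W \<omega> * centred \<omega> t)
      = (LINT s|lebesgue_on I. b s * (LINT \<omega>|M. centred \<omega> s * centred \<omega> t))"
    unfolding W_def
    by (rule kernel_apply_assoc[OF sigma_finite_I sigma_finite_M sigma_finite_I b
        sq_integrable_swap[OF sigma_finite_M sigma_finite_I L2_centred] L2_centred])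
  moreover have "AE t in lebesgue_on I. sq_integrable M (\<lambda>\<omega>. X \<omega> t)"
    by (rule sq_integrable_section_snd[OF sigma_finite_M sigma_finite_I L2_process])
  ultimately show ?thesis
    using AE_space
  proof eventually_elim
    case (elim t)
    then have t: "t \<in> I" by simp
    have Zt: "sq_integrable M (\<lambda>\<omega>. centred \<omega> t)"
      by (intro sq_integrable_diff elim sq_integrable_const)
    have mean_zero: "(LINT \<omega>|M. centred \<omega> t) = 0"
      using sq_integrable_imp_integrable[OF elim(2)] by (simp add: mean_fun_def prob_space)
    let ?k = "c - (LINT \<omega>|M. Y \<omega>)"
    have "(LINT \<omega>|M. centred \<omega> t * (Y \<omega> - (LINT \<omega>|M. Y \<omega>)))
        = (LINT \<omega>|M. ?k * centred \<omega> t + W \<omega> * centred \<omega> t + centred \<omega> t * \<epsilon> \<omega>)"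
    proof (rule integral_cong_AE)
      show "AE \<omega> in M. centred \<omega> t * (Y \<omega> - (LINT \<omega>|M. Y \<omega>))
          = ?k * centred \<omega> t + W \<omega> * centred \<omega> t + centred \<omega> t * \<epsilon> \<omega>"
        using c by eventually_elim (simp add: algebra_simps)
    qed (use sq_integrable_measurable[OF Zt] sq_integrable_measurable[OF W] sq_integrable_measurable[OF \<epsilon>] Y
        in \<open>auto intro!: borel_measurable_times borel_measurable_add borel_measurable_diff\<close>)
    also have "\<dots> = ?k * (LINT \<omega>|M. centred \<omega> t) + (LINT \<omega>|M. W \<omega> * centred \<omega> t)
        + (LINT \<omega>|M. centred \<omega> t * \<epsilon> \<omega>)"
      using sq_integrable_imp_integrable[OF Zt] integrable_mult_sq[OF W Zt] integrable_mult_sq[OF Zt \<epsilon>]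
      by (subst Bochner_Integration.integral_add Bochner_Integration.integrable_add
          integrable_mult_right integral_mult_right_zero; simp)+
    also have "\<dots> = (LINT \<omega>|M. W \<omega> * centred \<omega> t)"
      unfolding mean_zero covariance_with_error[OF \<epsilon> cond t Zt] by simp
    also have "\<dots> = int_op I (cov_kernel M X) b t"
      using elim(1) by (simp add: int_op_def cov_kernel_def)
    finally show ?case .
  qed
qed

end

end

section \<open>The expansion\<close>

theorem theorem5p1:
  fixes M :: "'w measure" and I :: "real set" and c d a :: real and b :: "real \<Rightarrow> real"
    and X :: "'w \<Rightarrow> real \<Rightarrow> real" and Y \<epsilon> :: "'w \<Rightarrow> real"
    and n :: nat and Xs :: "nat \<Rightarrow> 'w \<Rightarrow> real \<Rightarrow> real" and Ys :: "nat \<Rightarrow> 'w \<Rightarrow> real"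
    and K :: "real \<Rightarrow> real \<Rightarrow> real"
    and \<xi> \<eta> :: "'w \<Rightarrow> real \<Rightarrow> real \<Rightarrow> real" and \<xi>0 \<eta>0 :: "'w \<Rightarrow> real \<Rightarrow> real"
  assumes M: "prob_space M"
    and I: "I = {c..d}" "c < d"
    and X: "random_function M I X"
    and X2: "(\<integral>\<^sup>+ t. (\<integral>\<^sup>+ \<omega>. ennreal ((X \<omega> t)\<^sup>2) \<partial>M) \<partial>lebesgue_on I) < \<infinity>"
    and X4: "(\<integral>\<^sup>+ \<omega>. (\<integral>\<^sup>+ t. ennreal ((X \<omega> t)\<^sup>2) \<partial>lebesgue_on I)\<^sup>2 \<partial>M) < \<infinity>"
    and b: "b \<in> borel_measurable (lebesgue_on I)"
    and b2: "integrable (lebesgue_on I) (\<lambda>t. (b t)\<^sup>2)"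
    and eps: "\<epsilon> \<in> borel_measurable M"
    and eps2: "integrable M (\<lambda>\<omega>. (\<epsilon> \<omega>)\<^sup>2)"
    and eps_cond: "AE \<omega> in M. real_cond_exp M (sigma_gen M I X) \<epsilon> \<omega> = 0"
    and Y: "Y \<in> borel_measurable M"
    and Y_eq: "AE \<omega> in M. Y \<omega> = a + (LINT t|lebesgue_on I. b t * X \<omega> t) + \<epsilon> \<omega>"
    and n: "n \<ge> 1"
    and Xs: "\<And>i. i \<in> {1..n} \<Longrightarrow> random_function M I (Xs i)"
    and Ys: "\<And>i. i \<in> {1..n} \<Longrightarrow> Ys i \<in> borel_measurable M"
    and indep: "prob_space.indep_vars M (\<lambda>_. path_space I \<Otimes>\<^sub>M borel)
        (\<lambda>i \<omega>. (restrict (Xs i \<omega>) I, Ys i \<omega>)) {1..n}"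
    and distr: "\<And>i. i \<in> {1..n} \<Longrightarrow>
        distr M (path_space I \<Otimes>\<^sub>M borel) (\<lambda>\<omega>. (restrict (Xs i \<omega>) I, Ys i \<omega>)) =
        distr M (path_space I \<Otimes>\<^sub>M borel) (\<lambda>\<omega>. (restrict (X \<omega>) I, Y \<omega>))"
    and K_eq: "K = cov_kernel M X"
    and \<xi>_eq: "\<xi> = \<xi>_ker M X n Xs"
    and \<eta>_eq: "\<eta> = \<eta>_ker M X n Xs"
    and \<xi>0_eq: "\<xi>0 = \<xi>_zero M X n Xs Ys"
    and \<eta>0_eq: "\<eta>0 = \<eta>_zero M X n Xs Ys"
  shows "\<exists>\<eta>j :: nat \<Rightarrow> 'w \<Rightarrow> real \<Rightarrow> real. \<forall>j\<ge>1.
      random_function M I (\<eta>j j) \<and>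
      (AE \<omega> in M.
        integrable (lebesgue_on I) (\<lambda>t. (\<eta>j j \<omega> t)\<^sup>2) \<and>
        (AE t in lebesgue_on I.
          K_hat_pow_b I n Xs Ys j \<omega> t =
            op_pow I K j b t + \<xi>_term I K b (\<xi> \<omega>) (\<xi>0 \<omega>) j t / sqrt (real n) + \<eta>j j \<omega> t / real n) \<and>
        norm1 I (\<eta>j j \<omega>) \<le>
          R1 I n K (\<xi> \<omega>) (\<eta> \<omega>) ^ (j - 1) * norm1 I (\<eta>0 \<omega>)
          + R2 I (\<xi> \<omega>) (\<eta> \<omega>) *
              (\<Sum>k=1..j - 1. R1 I n K (\<xi> \<omega>) (\<eta> \<omega>) ^ (j - k - 1) *
                 (norm1 I (op_pow I K k b) + norm_pow I K (k - 1) * norm1 I (\<xi>0 \<omega>)))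
          + R2 I (\<xi> \<omega>) (\<eta> \<omega>) * norm2 I (\<xi> \<omega>) *
              (\<Sum>k=1..j - 1. R1 I n K (\<xi> \<omega>) (\<eta> \<omega>) ^ (j - k - 1) *
                 (\<Sum>l<k - 1. norm_pow I K l * norm1 I (op_pow I K (k - l - 1) b))))"
proof -
  interpret prob_space M by (rule M)
  interpret X: L2_process I M X
    using I X X2 by unfold_locales auto
  have \<epsilon>_L2: "sq_integrable M \<epsilon>"
    using eps eps2 by (simp add: sq_integrable_def)
  have b_L2: "X.L2_fun b"
    using b b2 by (simp add: sq_integrable_def)
  note Y_L2 = X.L2_response[OF b_L2 \<epsilon>_L2 Y Y_eq]
  define EY where "EY = (LINT \<omega>|M. Y \<omega>)"
  \<comment> \<open>The covariance of \<open>X\<close> and \<open>Y\<close> is kept apart from K(b),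
    to which it is equal only for almost every \<open>t\<close>. With \<open>C\<close> the expansion
    of \<open>K_hat1_b\<close> holds at every point of \<open>I\<close>.\<close>
  define C where "C t = (LINT \<omega>|M. X.centred \<omega> t * (Y \<omega> - EY))" for t
  have C_L2: "X.L2_fun C" and C_eq: "AE t in lebesgue_on I. C t = int_op I K b t"
    unfolding C_def[abs_def] EY_def K_eq
    by (rule X.L2_response_covariance[OF b_L2 \<epsilon>_L2 Y Y_eq] X.response_covariance[OF b_L2 \<epsilon>_L2 Y Y_eq eps_cond])+
  have K_L2: "X.L2_kernel K"
    unfolding K_eq by (rule X.L2_cov_kernel)

  have at_measurable[measurable]: "(\<lambda>x. x t) \<in> borel_measurable (path_space I)" if "t \<in> I" for t
    unfolding path_space_def using that by measurable
  have Xs_L2: "L2_process I M (Xs i)" if i: "i \<in> {1..n}" for i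
  proof unfold_locales
    have "(\<integral>\<^sup>+ t. (\<integral>\<^sup>+ \<omega>. ennreal ((Xs i \<omega> t)\<^sup>2) \<partial>M) \<partial>lebesgue_on I)
        = (\<integral>\<^sup>+ t. (\<integral>\<^sup>+ \<omega>. ennreal ((X \<omega> t)\<^sup>2) \<partial>M) \<partial>lebesgue_on I)"
      by (intro nn_integral_cong same_distr_nn_integral_sq[OF X Xs[OF i] Y Ys[OF i] distr[OF i]]) simp
    then show "(\<integral>\<^sup>+ t. (\<integral>\<^sup>+ \<omega>. ennreal ((Xs i \<omega> t)\<^sup>2) \<partial>M) \<partial>lebesgue_on I) < \<infinity>"
      using X2 by simp
  qed (rule Xs[OF i])
  have Ys_integrable: "integrable M (Ys i)" and Ys_mean: "(LINT \<omega>|M. Ys i \<omega>) = EY" if i: "i \<in> {1..n}" for i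
    using same_distr_integrable[OF X Xs[OF i] Y Ys[OF i] distr[OF i], of snd]
      same_distr_integral[OF X Xs[OF i] Y Ys[OF i] distr[OF i], of snd]
      sq_integrable_imp_integrable[OF Y_L2]
    by (simp_all add: EY_def)
  have Y_bar_mean: "(LINT \<omega>|M. Y_bar n Ys \<omega>) = EY"
    using n Ys_integrable by (simp add: Y_bar_def Ys_mean)
  \<comment> \<open>Valid at every \<open>s\<close> and \<open>t\<close> in \<open>I\<close>, even
    where the product is not integrable, since both sides are then 0. This is why the decomposition
    of \<open>K_hat\<close> needs no exceptional set.\<close>
  have Xs_cov: "(LINT \<omega>|M. (Xs i \<omega> s - mean_fun M X s) * (Xs i \<omega> t - mean_fun M X t)) = K s t"
    if i: "i \<in> {1..n}" and "s \<in> I" "t \<in> I" for i s t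
  proof -
    let ?g = "\<lambda>p. (fst p s - mean_fun M X s) * (fst p t - mean_fun M X t)"
    have "?g \<in> borel_measurable (path_space I \<Otimes>\<^sub>M borel)"
      using \<open>s \<in> I\<close> \<open>t \<in> I\<close> by measurable
    from same_distr_integral[OF X Xs[OF i] Y Ys[OF i] distr[OF i] this] show ?thesis
      using \<open>s \<in> I\<close> \<open>t \<in> I\<close> by (simp add: K_eq cov_kernel_def)
  qed
  have Xs_Ys_cov: "(LINT \<omega>|M. (Xs i \<omega> t - mean_fun M X t) * (Ys i \<omega> - EY)) = C t"
    if i: "i \<in> {1..n}" and "t \<in> I" for i t
  proof -
    let ?g = "\<lambda>p. (fst p t - mean_fun M X t) * (snd p - EY)"
    have "?g \<in> borel_measurable (path_space I \<Otimes>\<^sub>M borel)"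
      using \<open>t \<in> I\<close> by measurable
    from same_distr_integral[OF X Xs[OF i] Y Ys[OF i] distr[OF i] this] show ?thesis
      using \<open>t \<in> I\<close> by (simp add: C_def)
  qed

  \<comment> \<open>With the expectations replaced by \<open>K\<close>, square integrability and
    measurability of \<open>\<xi>\<close> reduce to those of the paths and of
    \<open>K\<close>.\<close>
  have \<xi>_I: "\<xi> \<omega> s t = ((\<Sum>i=1..n. (Xs i \<omega> s - mean_fun M X s) * (Xs i \<omega> t - mean_fun M X t)) - real n * K s t) / sqrt (real n)"
    if "s \<in> I" "t \<in> I" for \<omega> s t
    using Xs_cov[OF _ that] by (simp add: \<xi>_eq \<xi>_ker_def centre_def sum_subtractf)
  have \<xi>0_I: "\<xi>0 \<omega> t = ((\<Sum>i=1..n. (Xs i \<omega> t - mean_fun M X t) * (Ys i \<omega> - EY)) - real n * C t) / sqrt (real n)"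
    if "t \<in> I" for \<omega> t
    using Xs_Ys_cov[OF _ that] by (simp add: \<xi>0_eq \<xi>_zero_def centre_def sum_subtractf Ys_mean)
  have K_hat_eq: "K_hat n Xs \<omega> s t = K s t + \<xi> \<omega> s t / sqrt (real n) + \<eta> \<omega> s t / real n"
    if "s \<in> I" "t \<in> I" for \<omega> s t
    using n unfolding \<xi>_I[OF that] \<eta>_eq \<eta>_ker_def K_hat_def X_bar_def
      sample_covariance[OF n, of "\<lambda>i. Xs i \<omega> s" "\<lambda>i. Xs i \<omega> t" "mean_fun M X s" "mean_fun M X t"]
    by (simp add: diff_divide_distrib)
  have K_hat1_eq: "K_hat1_b n Xs Ys \<omega> t = C t + \<xi>0 \<omega> t / sqrt (real n) + \<eta>0 \<omega> t / real n"
    if "t \<in> I" for \<omega> t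
    using n unfolding \<xi>0_I[OF that] \<eta>0_eq \<eta>_zero_def Y_bar_mean K_hat1_b_def X_bar_def Y_bar_def
      sample_covariance[OF n, of "\<lambda>i. Xs i \<omega> t" "\<lambda>i. Ys i \<omega>" "mean_fun M X t" EY]
    by (simp add: diff_divide_distrib)

  note \<mu>_L2 = X.L2_mean_fun
  have L2_realised: "X.L2_kernel (\<xi> \<omega>) \<and> X.L2_kernel (\<eta> \<omega>) \<and> X.L2_fun (\<xi>0 \<omega>) \<and> X.L2_fun (\<eta>0 \<omega>)"
    if paths: "\<And>i. i \<in> {1..n} \<Longrightarrow> X.L2_fun (Xs i \<omega>)" for \<omega>
  proof (intro conjI)
    have Z: "X.L2_fun (\<lambda>t. Xs i \<omega> t - mean_fun M X t)" if "i \<in> {1..n}" for i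
      by (intro sq_integrable_diff paths that \<mu>_L2)
    have Z_bar: "X.L2_fun (\<lambda>t. X_bar n Xs \<omega> t - mean_fun M X t)"
      unfolding X_bar_def by (intro sq_integrable_diff sq_integrable_divide sq_integrable_sum paths \<mu>_L2)
    have "sq_integrable (lebesgue_on I \<Otimes>\<^sub>M lebesgue_on I)
        (\<lambda>p. ((\<Sum>i=1..n. case p of (s, t) \<Rightarrow> (Xs i \<omega> s - mean_fun M X s) * (Xs i \<omega> t - mean_fun M X t))
          - real n * (case p of (s, t) \<Rightarrow> K s t)) / sqrt (real n))"
      by (intro sq_integrable_divide sq_integrable_diff sq_integrable_sum sq_integrable_cmult K_L2
          sq_integrable_tensor[OF X.sigma_finite_I X.sigma_finite_I] Z)
    then show "X.L2_kernel (\<xi> \<omega>)"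
      by (rule iffD1[OF sq_integrable_cong, rotated]) (auto simp: \<xi>_I space_pair_measure)
    have "sq_integrable (lebesgue_on I \<Otimes>\<^sub>M lebesgue_on I)
        (\<lambda>p. - real n * (case p of (s, t) \<Rightarrow> (X_bar n Xs \<omega> s - mean_fun M X s) * (X_bar n Xs \<omega> t - mean_fun M X t)))"
      by (intro sq_integrable_cmult sq_integrable_tensor[OF X.sigma_finite_I X.sigma_finite_I] Z_bar)
    then show "X.L2_kernel (\<eta> \<omega>)"
      by (simp add: \<eta>_eq \<eta>_ker_def case_prod_unfold mult.assoc)
    \<comment> \<open>The factors are exchanged so that the one constant in \<open>t\<close> stands
      in front, as \<open>sq_integrable_cmult\<close> expects.\<close>
    have "X.L2_fun (\<lambda>t. ((\<Sum>i=1..n. (Ys i \<omega> - EY) * (Xs i \<omega> t - mean_fun M X t)) - real n * C t) / sqrt (real n))"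
      by (intro sq_integrable_divide sq_integrable_diff sq_integrable_sum sq_integrable_cmult C_L2 Z)
    then show "X.L2_fun (\<xi>0 \<omega>)"
      by (rule iffD1[OF sq_integrable_cong, rotated]) (auto simp: \<xi>0_I mult.commute)
    have "X.L2_fun (\<lambda>t. (- real n * (Y_bar n Ys \<omega> - EY)) * (X_bar n Xs \<omega> t - mean_fun M X t))"
      by (intro sq_integrable_cmult Z_bar)
    then show "X.L2_fun (\<eta>0 \<omega>)"
      by (simp add: \<eta>0_eq \<eta>_zero_def[abs_def] Y_bar_mean mult_ac)
  qed
  have AE_paths: "AE \<omega> in M. \<forall>i\<in>{1..n}. X.L2_fun (Xs i \<omega>)"
    by (intro AE_finite_allI L2_process.AE_L2_paths Xs_L2) simp

  note [measurable] = sq_integrable_measurable[OF K_L2] sq_integrable_measurable[OF C_L2]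
    sq_integrable_measurable[OF \<mu>_L2] Ys
  have Xs_fst: "(\<lambda>(\<omega>, s, t). Xs i \<omega> s) \<in> borel_measurable (M \<Otimes>\<^sub>M (lebesgue_on I \<Otimes>\<^sub>M lebesgue_on I))"
    and Xs_snd: "(\<lambda>(\<omega>, s, t). Xs i \<omega> t) \<in> borel_measurable (M \<Otimes>\<^sub>M (lebesgue_on I \<Otimes>\<^sub>M lebesgue_on I))"
    and Xs_pair: "(\<lambda>(\<omega>, t). Xs i \<omega> t) \<in> borel_measurable (M \<Otimes>\<^sub>M lebesgue_on I)"
    if i: "i \<in> {1..n}" for i
  proof -
    show [measurable]: "(\<lambda>(\<omega>, t). Xs i \<omega> t) \<in> borel_measurable (M \<Otimes>\<^sub>M lebesgue_on I)"
      by (rule random_function_pair_measurable[OF Xs[OF i]])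
    show "(\<lambda>(\<omega>, s, t). Xs i \<omega> s) \<in> borel_measurable (M \<Otimes>\<^sub>M (lebesgue_on I \<Otimes>\<^sub>M lebesgue_on I))"
      "(\<lambda>(\<omega>, s, t). Xs i \<omega> t) \<in> borel_measurable (M \<Otimes>\<^sub>M (lebesgue_on I \<Otimes>\<^sub>M lebesgue_on I))"
      by measurable
  qed
  have K_hat_measurable: "(\<lambda>(\<omega>, s, t). K_hat n Xs \<omega> s t) \<in> borel_measurable (M \<Otimes>\<^sub>M (lebesgue_on I \<Otimes>\<^sub>M lebesgue_on I))"
    using Xs_fst Xs_snd unfolding K_hat_def X_bar_def case_prod_unfold
    by (intro borel_measurable_divide borel_measurable_sum borel_measurable_times borel_measurable_diff
        borel_measurable_const) auto
  have \<xi>_measurable: "(\<lambda>(\<omega>, s, t). \<xi> \<omega> s t) \<in> borel_measurable (M \<Otimes>\<^sub>M (lebesgue_on I \<Otimes>\<^sub>M lebesgue_on I))"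
  proof (rule iffD1[OF measurable_cong])
    show "(\<lambda>(\<omega>, s, t). ((\<Sum>i=1..n. (Xs i \<omega> s - mean_fun M X s) * (Xs i \<omega> t - mean_fun M X t)) - real n * K s t) / sqrt (real n))
        \<in> borel_measurable (M \<Otimes>\<^sub>M (lebesgue_on I \<Otimes>\<^sub>M lebesgue_on I))"
      using Xs_fst Xs_snd unfolding case_prod_unfold
      by (intro borel_measurable_divide borel_measurable_sum borel_measurable_times borel_measurable_diff
          borel_measurable_const) auto
  qed (auto simp: \<xi>_I space_pair_measure)
  have K_hat1_random: "random_function M I (K_hat1_b n Xs Ys)"
    using Xs_pair Ys unfolding random_function_def K_hat1_b_def X_bar_def Y_bar_def case_prod_unfold
    by (intro borel_measurable_divide borel_measurable_sum borel_measurable_times borel_measurable_diff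
        borel_measurable_const) auto
  have \<xi>0_random: "random_function M I \<xi>0"
    unfolding random_function_def
  proof (rule iffD1[OF measurable_cong])
    show "(\<lambda>(\<omega>, t). ((\<Sum>i=1..n. (Xs i \<omega> t - mean_fun M X t) * (Ys i \<omega> - EY)) - real n * C t) / sqrt (real n))
        \<in> borel_measurable (M \<Otimes>\<^sub>M lebesgue_on I)"
      using Xs_pair Ys unfolding case_prod_unfold
      by (intro borel_measurable_divide borel_measurable_sum borel_measurable_times borel_measurable_diff
          borel_measurable_const) auto
  qed (auto simp: \<xi>0_I space_pair_measure)
  have Kb_L2: "X.L2_fun (op_pow I K j b)" for j
    by (intro X.L2_op_pow K_L2 b_L2)

  \<comment> \<open>The expansion forces this choice up to null sets. It is made for all
    \<open>j\<close> at once, as the existential stands outside the quantifier over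
    \<open>j\<close>.\<close>
  define \<eta>j where "\<eta>j j \<omega> t = real n * (K_hat_pow_b I n Xs Ys j \<omega> t - op_pow I K j b t
      - \<xi>_term I K b (\<xi> \<omega>) (\<xi>0 \<omega>) j t / sqrt (real n))" for j \<omega> t
  have \<eta>j_random: "random_function M I (\<eta>j j)" for j
  proof -
    have \<zeta>_random: "random_function M I (\<lambda>\<omega>. \<zeta> I K b (\<xi> \<omega>) m)" for m
      using X.random_function_int_op[OF \<xi>_measurable
          X.random_function_const[OF sq_integrable_measurable[OF Kb_L2]]]
      by (simp add: \<zeta>_def[abs_def] int_op_def[abs_def])
    have [measurable]: "(\<lambda>(\<omega>, t). op_pow I K k (\<zeta> I K b (\<xi> \<omega>) m) t) \<in> borel_measurable (M \<Otimes>\<^sub>M lebesgue_on I)" for k m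
      using X.random_function_op_pow[OF sq_integrable_measurable[OF K_L2] \<zeta>_random]
      by (simp add: random_function_def)
    have [measurable]: "(\<lambda>(\<omega>, t). op_pow I K k (\<xi>0 \<omega>) t) \<in> borel_measurable (M \<Otimes>\<^sub>M lebesgue_on I)" for k
      using X.random_function_op_pow[OF sq_integrable_measurable[OF K_L2] \<xi>0_random]
      by (simp add: random_function_def)
    have [measurable]: "(\<lambda>(\<omega>, t). K_hat_pow_b I n Xs Ys j \<omega> t) \<in> borel_measurable (M \<Otimes>\<^sub>M lebesgue_on I)"
      using X.random_function_int_op_pow[OF K_hat_measurable K_hat1_random]
      by (simp add: random_function_def K_hat_pow_b_def)
    note [measurable] = sq_integrable_measurable[OF Kb_L2]
    show ?thesis
      unfolding random_function_def \<eta>j_def \<xi>_term_def by measurable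
  qed
  show ?thesis
  proof (intro exI[of _ \<eta>j] allI impI conjI \<eta>j_random)
    fix j :: nat
    assume "j \<ge> 1"
    then obtain m where m: "j = Suc m" by (cases j) auto
    show "AE \<omega> in M.
        integrable (lebesgue_on I) (\<lambda>t. (\<eta>j j \<omega> t)\<^sup>2) \<and>
        (AE t in lebesgue_on I.
          K_hat_pow_b I n Xs Ys j \<omega> t =
            op_pow I K j b t + \<xi>_term I K b (\<xi> \<omega>) (\<xi>0 \<omega>) j t / sqrt (real n) + \<eta>j j \<omega> t / real n) \<and>
        norm1 I (\<eta>j j \<omega>) \<le>
          R1 I n K (\<xi> \<omega>) (\<eta> \<omega>) ^ (j - 1) * norm1 I (\<eta>0 \<omega>)
          + R2 I (\<xi> \<omega>) (\<eta> \<omega>) *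
              (\<Sum>k=1..j - 1. R1 I n K (\<xi> \<omega>) (\<eta> \<omega>) ^ (j - k - 1) *
                 (norm1 I (op_pow I K k b) + norm_pow I K (k - 1) * norm1 I (\<xi>0 \<omega>)))
          + R2 I (\<xi> \<omega>) (\<eta> \<omega>) * norm2 I (\<xi> \<omega>) *
              (\<Sum>k=1..j - 1. R1 I n K (\<xi> \<omega>) (\<eta> \<omega>) ^ (j - k - 1) *
                 (\<Sum>l<k - 1. norm_pow I K l * norm1 I (op_pow I K (k - l - 1) b)))"
      using AE_paths AE_space
    proof eventually_elim
      case (elim \<omega>)
      with L2_realised have L2: "X.L2_kernel (\<xi> \<omega>)" "X.L2_kernel (\<eta> \<omega>)" "X.L2_fun (\<xi>0 \<omega>)" "X.L2_fun (\<eta>0 \<omega>)"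
        by blast+
      \<comment> \<open>The null set of \<open>t\<close> comes solely from \<open>C_eq\<close>;
        \<open>K_hat1_eq\<close> holds throughout \<open>I\<close>.\<close>
      have g: "AE t in lebesgue_on I. K_hat1_b n Xs Ys \<omega> t
          = int_op I K b t + \<xi>0 \<omega> t / sqrt (real n) + \<eta>0 \<omega> t / real n"
        using C_eq AE_space by eventually_elim (simp add: K_hat1_eq)
      have g_meas: "K_hat1_b n Xs Ys \<omega> \<in> borel_measurable (lebesgue_on I)"
        using measurable_Pair2[OF random_function_pair_measurable[OF K_hat1_random] elim(2)] by simp
      have \<eta>j: "\<eta>j j \<omega> = (\<lambda>t. real n * ((int_op I (K_hat n Xs \<omega>) ^^ (j - 1)) (K_hat1_b n Xs Ys \<omega>) t
          - op_pow I K j b t - \<xi>_term I K b (\<xi> \<omega>) (\<xi>0 \<omega>) j t / sqrt (real n)))" for j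
        by (rule ext) (simp add: \<eta>j_def K_hat_pow_b_def)
      note rem = X.L2_iterate_remainder[OF n K_L2 L2(1,2) b_L2 L2(3,4) K_hat_eq g_meas g, folded \<eta>j]
        X.norm1_iterate_remainder_le[OF n K_L2 L2(1,2) b_L2 L2(3,4) K_hat_eq g_meas g, folded \<eta>j]
      show ?case
      proof (intro conjI rem(2) \<open>j \<ge> 1\<close>)
        show "integrable (lebesgue_on I) (\<lambda>t. (\<eta>j j \<omega> t)\<^sup>2)"
          using sq_integrable_integrable[OF rem(1)] by (simp add: m)
        show "AE t in lebesgue_on I. K_hat_pow_b I n Xs Ys j \<omega> t =
            op_pow I K j b t + \<xi>_term I K b (\<xi> \<omega>) (\<xi>0 \<omega>) j t / sqrt (real n) + \<eta>j j \<omega> t / real n"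
          using n by (simp add: \<eta>j_def)
      qed
    qed
  qed
qed

end
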